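(* Let $\mathcal D\subseteq\mathbb R^n$ be a domain, $x^*\in\mathcal D$, and let $J\in C^2(\mathcal D;\mathbb R)$ satisfy: (i) $J(x)>J(x^* )$ for all $x\in\mathcal D\setminus\{x^*\}$; (ii) for $x\in\mathcal D$, $\nabla J(x)=0$ if and only if $x=x^*$. Let $\phi_1,\phi_2,\psi_{11},\psi_{12},\psi_{21},\psi_{22}\in C^2(\mathbb R;\mathbb R)$ satisfy $[\phi_1,\phi_2]\equiv-1$ (that is, $\phi_1\phi_2'-\phi_1'\phi_2\equiv-1$) and $\psi_{11}\psi_{21}'+\psi_{12}\psi_{22}'\equiv1$ on $\mathbb R$. Let $\epsilon>0$, $\alpha_i,\beta_i,\gamma_i>0$ $(i=1,\dots,n)$, and let $\kappa_i,\varkappa_{i1},\varkappa_{i2}\in\mathbb N$, $i=1,\dots,n$, be pairwise distinct ($3n$ distinct numbers). Consider, for the frequency parameter $\omega>0$, the system with state $\bar q=(\bar x^\top,\bar v^\top,\bar\eta^\top)^\top\in\mathbb R^{3n}$: $$\begin{aligned} \dot{\bar x}_i={}&\sqrt{2\alpha_i\kappa_i\omega}\Big(\phi_1\Big(\tfrac{J(\bar x)}{\sqrt{\bar v_i+\epsilon}}\Big)\cos(\kappa_i\omega t)+\phi_2\Big(\tfrac{J(\bar x)}{\sqrt{\bar v_i+\epsilon}}\Big)\sin(\kappa_i\omega t)\Big)\\ &+\sqrt{2\gamma_i\omega}\Big(\sqrt{\varkappa_{i1}}\,\psi_{11}(J(\bar x))\cos(\varkappa_{i1}\omega t)+\sqrt{\varkappa_{i2}}\,\psi_{12}(J(\bar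 x))\cos(\varkappa_{i2}\omega t)\Big),\\ \dot{\bar v}_i={}&-\beta_i(\bar v_i-\bar\eta_i^2),\\ \dot{\bar\eta}_i={}&-\gamma_i\bar\eta_i+\sqrt{2\gamma_i\omega}\Big(\sqrt{\varkappa_{i1}}\,\psi_{21}(J(\bar x))\sin(\varkappa_{i1}\omega t)+\sqrt{\varkappa_{i2}}\,\psi_{22}(J(\bar x))\sin(\varkappa_{i2}\omega t)\Big), \end{aligned}$$ $i=1,\dots,n$. Then the point $q^*=({x^*}^\top,0^\top,0^\top)^\top$ is practically uniformly asymptotically stable for this system provided that the initial values of the $\bar v$-components satisfy $\bar v_i(0)\ge0$, $i=1,\dots,n$.
   Context: Notation: $\nabla J$ is the gradient of $J$. For scalar functions of one variable, $[f,g]=fg'-f'g$. The system is considered for $\bar x\in\mathcal D$, $\bar v_i>-\epsilon$, $\bar\eta\in\mathbb R^n$. Practical uniform asymptotic stability (the frequency $\omega$ being the parameter, and initial conditions being restricted to $\mathcal S=\{\bar q:\bar v_i\ge0,\ i=1,\dots,n\}$) of $q^*$ means that both of the following hold. (1) Practical uniform stability: for every $\varepsilon>0$ there exist $\delta>0$ and $\omega_0>0$ such that for all $\omega>\omega_0$ and all initial times $t_0\ge 0$, every solution with $\bar q(t_0)\in\mathcal S$ and $\|\bar q(t_0)-q^*\|<\delta$ exists for all $t\ge t_0$ and satisfies $\|\bar q(t)-q^*\|<\varepsilon$ for all $t\ge t_0$. (2) Practical uniform attractivity: there exists $\delta>0$ such that for every $\varepsilon>0$ there exist $t_f\ge0$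 and $\omega_0>0$ such that for all $\omega>\omega_0$ and all $t_0\ge0$, every solution with $\bar q(t_0)\in\mathcal S$ and $\|\bar q(t_0)-q^*\|<\delta$ exists for all $t\ge t_0$ and satisfies $\|\bar q(t)-q^*\|<\varepsilon$ for all $t\ge t_0+t_f$. *)

theory Defs
  imports "HOL-Analysis.Analysis"
begin

text \<open>Twice continuously differentiable on \<open>S\<close>, which is meant to be open; the derivatives are
  Frechet derivatives, and continuity of the first one follows from its differentiability.\<close>

definition C2_on :: "'a::real_normed_vector set \<Rightarrow> ('a \<Rightarrow> 'b::real_normed_vector) \<Rightarrow> bool" where
  "C2_on S f \<longleftrightarrow>
     (\<exists>(f' :: 'a \<Rightarrow> 'a \<Rightarrow>\<^sub>L 'b) (f'' :: 'a \<Rightarrow> 'a \<Rightarrow>\<^sub>L 'a \<Rightarrow>\<^sub>L 'b).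
        (\<forall>x\<in>S. (f has_derivative blinfun_apply (f' x)) (at x)) \<and>
        (\<forall>x\<in>S. (f' has_derivative blinfun_apply (f'' x)) (at x)) \<and>
        continuous_on S f'')"

definition bracket :: "(real \<Rightarrow> real) \<Rightarrow> (real \<Rightarrow> real) \<Rightarrow> real \<Rightarrow> real" where
  "bracket f g y = f y * deriv g y - deriv f y * g y"

definition solution_on ::
  "(real \<Rightarrow> 'a \<Rightarrow> 'a) \<Rightarrow> 'a::real_normed_vector set \<Rightarrow> real set \<Rightarrow> (real \<Rightarrow> 'a) \<Rightarrow> bool" where
  "solution_on f \<Omega> I q \<longleftrightarrow>
     (\<forall>t\<in>I. q t \<in> \<Omega> \<and> (q has_vector_derivative f t (q t)) (at t within I))"

text \<open>A forward solution on an interval \<open>I\<close> with left endpoint \<open>t0\<close> that cannot be continued to a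
  larger such interval; only the values of \<open>q\<close> on \<open>I\<close> matter. The degenerate interval \<open>{t0}\<close>
  is allowed, so from every initial state in \<open>\<Omega>\<close> there starts a maximal solution, and a
  statement about all maximal solutions that entails \<open>I = {t0..}\<close> includes local existence.\<close>

definition maximal_solution ::
  "(real \<Rightarrow> 'a \<Rightarrow> 'a) \<Rightarrow> 'a::real_normed_vector set \<Rightarrow> real \<Rightarrow> real set \<Rightarrow> (real \<Rightarrow> 'a) \<Rightarrow> bool" where
  "maximal_solution f \<Omega> t0 I q \<longleftrightarrow>
     is_interval I \<and> t0 \<in> I \<and> I \<subseteq> {t0..} \<and> solution_on f \<Omega> I q \<and>
     (\<forall>I' q'. is_interval I' \<and> I \<subseteq> I' \<and> I' \<subseteq> {t0..} \<and> solution_on f \<Omega> I' q' \<and>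
        (\<forall>t\<in>I. q' t = q t) \<longrightarrow> I' = I)"

text \<open>In the following, \<open>F \<omega>\<close> is the time-varying vector field for frequency \<open>\<omega>\<close>, \<open>\<Omega>\<close> the set on
  which the system is considered and \<open>S\<close> the set of admissible initial states.\<close>

definition practically_uniformly_stable ::
  "(real \<Rightarrow> real \<Rightarrow> 'a \<Rightarrow> 'a) \<Rightarrow> 'a::real_normed_vector set \<Rightarrow> 'a set \<Rightarrow> 'a \<Rightarrow> bool" where
  "practically_uniformly_stable F \<Omega> S qs \<longleftrightarrow>
     (\<forall>e>0. \<exists>\<delta>>0. \<exists>\<omega>0>0. \<forall>\<omega>>\<omega>0. \<forall>t0\<ge>0. \<forall>I q.
        maximal_solution (F \<omega>) \<Omega> t0 I q \<and> q t0 \<in> S \<and> norm (q t0 - qs) < \<delta> \<longrightarrow>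
        I = {t0..} \<and> (\<forall>t\<ge>t0. norm (q t - qs) < e))"

definition practically_uniformly_attractive ::
  "(real \<Rightarrow> real \<Rightarrow> 'a \<Rightarrow> 'a) \<Rightarrow> 'a::real_normed_vector set \<Rightarrow> 'a set \<Rightarrow> 'a \<Rightarrow> bool" where
  "practically_uniformly_attractive F \<Omega> S qs \<longleftrightarrow>
     (\<exists>\<delta>>0. \<forall>e>0. \<exists>tf\<ge>0. \<exists>\<omega>0>0. \<forall>\<omega>>\<omega>0. \<forall>t0\<ge>0. \<forall>I q.
        maximal_solution (F \<omega>) \<Omega> t0 I q \<and> q t0 \<in> S \<and> norm (q t0 - qs) < \<delta> \<longrightarrow>
        I = {t0..} \<and> (\<forall>t\<ge>t0 + tf. norm (q t - qs) < e))"

definition practically_uniformly_asymptotically_stable ::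
  "(real \<Rightarrow> real \<Rightarrow> 'a \<Rightarrow> 'a) \<Rightarrow> 'a::real_normed_vector set \<Rightarrow> 'a set \<Rightarrow> 'a \<Rightarrow> bool" where
  "practically_uniformly_asymptotically_stable F \<Omega> S qs \<longleftrightarrow>
     practically_uniformly_stable F \<Omega> S qs \<and> practically_uniformly_attractive F \<Omega> S qs"

text \<open>The state \<open>(x, v, \<eta>)\<close>; the product norm on this type is the Euclidean norm.\<close>

type_synonym 'n state = "(real ^ 'n) \<times> (real ^ 'n) \<times> (real ^ 'n)"

definition es_domain :: "(real ^ 'n) set \<Rightarrow> real \<Rightarrow> ('n::finite) state set" where
  "es_domain D \<epsilon> = {(x, v, \<eta>). x \<in> D \<and> (\<forall>i. v $ i > - \<epsilon>)}"

definition es_initial :: "('n::finite) state set" where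
  "es_initial = {(x, v, \<eta>). \<forall>i. v $ i \<ge> 0}"

text \<open>\<open>k\<close>, \<open>l1\<close>, \<open>l2\<close> are the frequency multipliers of the \<open>\<phi>\<close>-, \<open>\<psi>11/\<psi>21\<close>- and
  \<open>\<psi>12/\<psi>22\<close>-terms.\<close>

definition es_field ::
  "(real ^ 'n \<Rightarrow> real) \<Rightarrow> (real \<Rightarrow> real) \<Rightarrow> (real \<Rightarrow> real) \<Rightarrow>
   (real \<Rightarrow> real) \<Rightarrow> (real \<Rightarrow> real) \<Rightarrow> (real \<Rightarrow> real) \<Rightarrow> (real \<Rightarrow> real) \<Rightarrow>
   real \<Rightarrow> ('n \<Rightarrow> real) \<Rightarrow> ('n \<Rightarrow> real) \<Rightarrow> ('n \<Rightarrow> real) \<Rightarrow>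
   ('n \<Rightarrow> nat) \<Rightarrow> ('n \<Rightarrow> nat) \<Rightarrow> ('n \<Rightarrow> nat) \<Rightarrow>
   real \<Rightarrow> real \<Rightarrow> ('n::finite) state \<Rightarrow> 'n state" where
  "es_field J \<phi>1 \<phi>2 \<psi>11 \<psi>12 \<psi>21 \<psi>22 \<epsilon> \<alpha> \<beta> \<gamma> k l1 l2 \<omega> t = (\<lambda>(x, v, \<eta>).
     ((\<chi> i. sqrt (2 * \<alpha> i * real (k i) * \<omega>) *
              (\<phi>1 (J x / sqrt (v $ i + \<epsilon>)) * cos (real (k i) * \<omega> * t)
             + \<phi>2 (J x / sqrt (v $ i + \<epsilon>)) * sin (real (k i) * \<omega> * t))
          + sqrt (2 * \<gamma> i * \<omega>) *
              (sqrt (real (l1 i)) * \<psi>11 (J x) * cos (real (l1 i) * \<omega> * t)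
             + sqrt (real (l2 i)) * \<psi>12 (J x) * cos (real (l2 i) * \<omega> * t))),
      (\<chi> i. - \<beta> i * (v $ i - (\<eta> $ i)\<^sup>2)),
      (\<chi> i. - \<gamma> i * \<eta> $ i
          + sqrt (2 * \<gamma> i * \<omega>) *
              (sqrt (real (l1 i)) * \<psi>21 (J x) * sin (real (l1 i) * \<omega> * t)
             + sqrt (real (l2 i)) * \<psi>22 (J x) * sin (real (l2 i) * \<omega> * t)))))"

end

theory Submission
  imports Defs
begin

text \<open>The near-identity transformation \<open>z = q + O(1/sqrt \<omega>)\<close> obtained by integrating the oscillating
  terms by parts twice turns a solution \<open>q\<close> of the system into a solution of the Lie bracket averaged
  system
  \<open>x' = - \<alpha> \<partial>J / sqrt (v + \<epsilon>)\<close>, \<open>v' = - \<beta> (v - \<eta>\<^sup>2)\<close>, \<open>\<eta>' = - \<gamma> (\<eta> - \<partial>J)\<close>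
  up to an error \<open>O(1/sqrt \<omega>)\<close>, uniformly on compact sets and in the initial time. The \<open>v\<close>-component
  carries no dither, so it is not changed by the transformation and stays nonnegative. On \<open>v \<ge> 0\<close> the
  averaged system has the strict Lyapunov function
  \<open>A (J x - J xs) + \<Sum>i. 2 \<eta>\<^sub>i\<^sup>2 / \<gamma>\<^sub>i + v\<^sub>i / \<beta>\<^sub>i\<close> with large \<open>A\<close>. Evaluated along \<open>z\<close> it decreases outside
  an arbitrarily small neighbourhood of the equilibrium once \<open>\<omega>\<close> is large. Only \<open>z\<close>, not \<open>J\<close>, is
  expanded to second order, which is why \<open>J \<in> C\<^sup>2\<close> suffices.\<close>

section \<open>Continuation of solutions\<close>

text \<open>Each dither has amplitude \<open>sqrt \<omega>\<close>, so the correction of size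
  \<open>1 / sqrt \<omega>\<close> that removes it meets a velocity of order
  \<open>sqrt \<omega>\<close> and leaves products of oscillations of order one. Their means need
  not vanish: they form the brackets, and a second correction of size \<open>1 / \<omega>\<close>
  removes the rest. Since the frequencies are distinct, only the two dithers sharing a frequency
  have a product with nonzero mean. Comparing trajectories of the two systems would give closeness
  on bounded time intervals only. The Lyapunov function is therefore inserted into the perturbed
  equation of \<open>z\<close>: decay at a fixed rate above a fixed level is an estimate without
  time horizon and yields stability and attractivity alike. The obstacle is circularity:
  \<open>z\<close> is controlled only while \<open>q\<close> stays in a compact ball, which is what
  has to be shown, and a maximal solution might stop. A first-exit argument breaks the circle, and
  continuation of solutions confined to a compact set then gives existence for all later
  times.\<close>

lemma solution_on_subset:
  assumes "solution_on f \<Omega> I q" "J \<subseteq> I" shows "solution_on f \<Omega> J q"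
  using assms unfolding solution_on_def by (meson has_vector_derivative_within_subset subsetD)

text \<open>Picard iteration as a contraction on bounded continuous functions with values in a ball
  around \<open>x0\<close>. It is used to show that a maximal solution cannot stop at the right end
  of a closed interval.\<close>

lemma picard_local_existence:
  fixes F :: "real \<Rightarrow> 'a::euclidean_space \<Rightarrow> 'a"
  assumes cont: "continuous_on (UNIV \<times> \<Omega>) (\<lambda>(t, x). F t x)"
    and lip: "local_lipschitz UNIV \<Omega> F" and "open \<Omega>" and "x0 \<in> \<Omega>"
  obtains h q where "h > 0" "q T = x0" "solution_on F \<Omega> {T..T + h} q"
proof -
  obtain u L where u: "u > 0" and L: "\<And>t. t \<in> cball T u \<Longrightarrow> L-lipschitz_on (cball x0 u \<inter> \<Omega>) (F t)"
    using local_lipschitzE[OF lip, of T x0] \<open>x0 \<in> \<Omega>\<close> by (metis Int_UNIV_right UNIV_I)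
  obtain r where r: "r > 0" "cball x0 r \<subseteq> \<Omega>" "r \<le> u"
    using \<open>open \<Omega>\<close> \<open>x0 \<in> \<Omega>\<close> u by (metis open_contains_cball min_def min.cobounded1 min.cobounded2 subset_cball subset_trans)
  let ?B = "cball x0 r"
  have "L \<ge> 0" using L[of T] u lipschitz_on_nonneg by fastforce
  have LB: "norm (F t x - F t y) \<le> L * norm (x - y)" if "t \<in> {T..T+u}" "x \<in> ?B" "y \<in> ?B" for t x y
  proof -
    have "L-lipschitz_on (cball x0 u \<inter> \<Omega>) (F t)" by (rule L) (use that in \<open>auto simp: dist_real_def\<close>)
    moreover have "x \<in> cball x0 u \<inter> \<Omega>" "y \<in> cball x0 u \<inter> \<Omega>" using that r by auto
    ultimately show ?thesis using lipschitz_onD[of L _ "F t" x y] by (simp add: dist_norm)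
  qed
  have "compact ((\<lambda>(t, x). F t x) ` ({T..T+u} \<times> ?B))"
    by (intro compact_continuous_image compact_Times continuous_on_subset[OF cont]) (use r in auto)
  then obtain M where M: "M > 0" "\<And>t x. t \<in> {T..T+u} \<Longrightarrow> x \<in> ?B \<Longrightarrow> norm (F t x) \<le> M"
    using compact_imp_bounded bounded_pos by (smt (verit) SigmaI case_prod_conv imageI)
  \<comment> \<open>\<open>M * h \<le> r\<close> keeps the iterates in the ball and
    \<open>L * h \<le> 1/2\<close> makes the map contract; \<open>L + 1\<close> avoids a division by
    zero.\<close>
  define h where "h = min u (min (r / M) (1 / (2 * (L + 1))))"
  have h: "h > 0" "h \<le> u" "M * h \<le> r" "L * h \<le> 1/2"
  proof -
    show "h > 0" "h \<le> u" using u r M \<open>L \<ge> 0\<close> by (auto simp: h_def)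
    have "h \<le> r / M" by (simp add: h_def)
    then show "M * h \<le> r" using M by (simp add: field_simps)
    have "h \<le> 1 / (2 * (L + 1))" by (simp add: h_def)
    then have "h * (2 * (L + 1)) \<le> 1" using \<open>L \<ge> 0\<close> by (simp add: pos_le_divide_eq)
    then show "L * h \<le> 1/2" using \<open>h > 0\<close> by (simp add: algebra_simps)
  qed
  \<comment> \<open>Clamping time to \<open>{T..T+h}\<close> turns every iterate into a bounded
    continuous function on the whole line, so the fixed point is sought in the complete space of
    such functions.\<close>
  define c where "c = (\<lambda>t. max T (min t (T + h)))"
  have c: "c t \<in> {T..T+h}" for t using h by (auto simp: c_def)
  have cT: "c t = t" if "t \<in> {T..T+h}" for t using that by (auto simp: c_def)
  have cc: "continuous_on UNIV c" unfolding c_def by (intro continuous_intros)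
  define X where "X = PiC UNIV (\<lambda>_::real. ?B)"
  define G where "G = (\<lambda>g::real \<Rightarrow>\<^sub>C 'a. \<lambda>t. x0 + integral {T..c t} (\<lambda>s. F s (g s)))"
  have gB: "g t \<in> ?B" if "g \<in> X" for g t
    using that mem_PiC_iff[of g] by (auto simp: X_def simp del: mem_cball)
  have contF: "continuous_on {T..T+h} (\<lambda>s. F s (apply_bcontfun g s))" if "g \<in> X" for g
  proof -
    have "continuous_on {T..T+h} ((\<lambda>(t, x). F t x) \<circ> (\<lambda>s. (s, apply_bcontfun g s)))"
      by (intro continuous_on_compose continuous_intros continuous_on_subset[OF cont])
        (use gB[OF that] r in auto)
    then show ?thesis by (simp add: o_def)
  qed
  have intF: "(\<lambda>s. F s (apply_bcontfun g s)) integrable_on {T..c t}" if "g \<in> X" for g t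
    using contF[OF that] c[of t] by (intro integrable_continuous_real continuous_on_subset[OF contF[OF that]]) auto
  have GB: "G g t \<in> ?B" if "g \<in> X" for g t
  proof -
    have "norm (integral {T..c t} (\<lambda>s. F s (g s))) \<le> M * (c t - T)"
      using c[of t] h by (intro integral_bound continuous_on_subset[OF contF[OF that]] M gB[OF that]) auto
    also have "\<dots> \<le> M * h" using c[of t] M by (intro mult_left_mono) auto
    finally show ?thesis using h by (simp add: G_def dist_norm)
  qed
  have G_bc: "G g \<in> bcontfun" if "g \<in> X" for g
  proof -
    have "continuous_on {T..T+h} (\<lambda>u. integral {T..u} (\<lambda>s. F s (g s)))"
      by (intro indefinite_integral_continuous_1 integrable_continuous_real contF that)
    then have "continuous_on UNIV ((\<lambda>u. integral {T..u} (\<lambda>s. F s (g s))) \<circ> c)"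
      by (intro continuous_on_compose cc) (use c in \<open>auto intro: continuous_on_subset\<close>)
    then have "continuous_on UNIV (G g)" unfolding G_def o_def by (intro continuous_intros)
    moreover have "bounded (range (G g))" by (rule bounded_subset[OF bounded_cball]) (use GB[OF that] in blast)
    ultimately show ?thesis by (simp add: bcontfun_def)
  qed
  define P where "P = (\<lambda>g. Bcontfun (G g))"
  have Pap: "apply_bcontfun (P g) = G g" if "g \<in> X" for g
    using G_bc[OF that] by (simp add: P_def Bcontfun_inverse)
  have "\<exists>!g\<in>X. P g = g"
  proof (rule Banach_fix[of X "1/2"])
    show "complete X" unfolding X_def
      by (intro complete_eq_closed[THEN iffD2] closed_PiC) auto
    show "X \<noteq> {}" using r mem_PiC_iff[of "const_bcontfun x0"] by (force simp: X_def const_bcontfun.rep_eq)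
    show "P ` X \<subseteq> X" using GB Pap by (auto simp: X_def mem_PiC_iff simp del: mem_cball)
    show "dist (P f) (P g) \<le> 1/2 * dist f g" if "f \<in> X" "g \<in> X" for f g
    proof (rule dist_bound)
      fix t
      have "G f t - G g t = integral {T..c t} (\<lambda>s. F s (f s) - F s (g s))"
        unfolding G_def by (simp add: integral_diff intF that)
      also have "norm \<dots> \<le> (L * dist f g) * (c t - T)"
      proof (rule integral_bound)
        show "T \<le> c t" using c[of t] by auto
        show "continuous_on {T..c t} (\<lambda>s. F s (f s) - F s (g s))"
          by (intro continuous_intros continuous_on_subset[OF contF] that) (use c[of t] in auto)
        fix s assume "s \<in> {T..c t}"
        then have "norm (F s (f s) - F s (g s)) \<le> L * norm (f s - g s)"
          using c[of t] h by (intro LB gB that) auto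
        also have "\<dots> \<le> L * dist f g" using dist_bounded[of f s g] \<open>L \<ge> 0\<close> by (intro mult_left_mono) (auto simp: dist_norm)
        finally show "norm (F s (f s) - F s (g s)) \<le> L * dist f g" .
      qed
      also have "\<dots> \<le> (L * dist f g) * h" using c[of t] \<open>L \<ge> 0\<close> by (intro mult_left_mono) auto
      also have "\<dots> = (L * h) * dist f g" by simp
      also have "\<dots> \<le> 1/2 * dist f g" using h by (intro mult_right_mono) auto
      finally show "dist (P f t) (P g t) \<le> 1/2 * dist f g" by (simp add: Pap that dist_norm)
    qed
  qed auto
  then obtain g where g: "g \<in> X" "P g = g" by blast
  have gG: "apply_bcontfun g = G g" using Pap[OF g(1)] g(2) by simp
  show thesis
  proof
    show "h > 0" by fact
    have "c T = T" using h by (simp add: c_def)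
    then show "g T = x0" by (subst gG) (simp add: G_def)
    show "solution_on F \<Omega> {T..T + h} g" unfolding solution_on_def
    proof (intro ballI conjI)
      fix t assume t: "t \<in> {T..T+h}"
      show "g t \<in> \<Omega>" using gB[OF g(1)] r by blast
      have "((\<lambda>u. x0 + integral {T..u} (\<lambda>s. F s (g s))) has_vector_derivative F t (g t)) (at t within {T..T + h})"
        using integral_has_vector_derivative[OF contF[OF g(1)] t] by (auto intro!: derivative_eq_intros)
      moreover have "g s = x0 + integral {T..s} (\<lambda>s. F s (g s))" if "s \<in> {T..T+h}" for s
        by (subst gG) (simp add: G_def cT[OF that])
      ultimately show "(g has_vector_derivative F t (g t)) (at t within {T..T + h})"
        by (rule has_vector_derivative_transform[OF t, rotated])
    qed
  qed
qed

lemma solution_on_append: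
  fixes F :: "real \<Rightarrow> 'a::euclidean_space \<Rightarrow> 'a"
  assumes "solution_on F \<Omega> {a..b} q" "solution_on F \<Omega> {b..c} g" "g b = q b" "a \<le> b" "b \<le> c"
  shows "solution_on F \<Omega> {a..c} (\<lambda>t. if t \<in> {a..b} then q t else g t)"
  unfolding solution_on_def
proof (intro ballI conjI)
  fix t assume t: "t \<in> {a..c}"
  let ?w = "\<lambda>t. if t \<in> {a..b} then q t else g t"
  show "?w t \<in> \<Omega>" using t assms by (auto simp: solution_on_def)
  have eq: "{a..b} \<inter> {b..c} = {b}" "{a..b} \<union> {b..c} = {a..c}" using assms by auto
  have "(?w has_vector_derivative (if t \<in> {a..b} then F t (q t) else F t (g t))) (at t within {a..c})"
    by (rule has_vector_derivative_If_within_closures[of t "{a..b}" "{b..c}"])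
      (use assms t in \<open>auto simp: solution_on_def eq insert_absorb\<close>)
  then show "(?w has_vector_derivative F t (?w t)) (at t within {a..c})"
    by (simp only: if_distrib[of "F t"])
qed

text \<open>A solution confined to a compact set has bounded speed, hence is Lipschitz and extends
  continuously to the endpoint; the integral equation survives the limit and returns the derivative
  there.\<close>

lemma solution_on_extend_right_endpoint:
  fixes F :: "real \<Rightarrow> 'a::euclidean_space \<Rightarrow> 'a"
  assumes cont: "continuous_on (UNIV \<times> \<Omega>) (\<lambda>(t, x). F t x)"
    and q: "solution_on F \<Omega> {a..<b} q" and "a < b"
    and K: "compact K" "K \<subseteq> \<Omega>" "\<And>t. t \<in> {a..<b} \<Longrightarrow> q t \<in> K"
  obtains g where "solution_on F \<Omega> {a..b} g" "\<And>t. t \<in> {a..<b} \<Longrightarrow> g t = q t"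
proof -
  have "compact ((\<lambda>(t, x). F t x) ` ({a..b} \<times> K))"
    by (intro compact_continuous_image compact_Times continuous_on_subset[OF cont]) (use K in auto)
  then obtain M where M: "M > 0" "\<And>t x. t \<in> {a..b} \<Longrightarrow> x \<in> K \<Longrightarrow> norm (F t x) \<le> M"
    using compact_imp_bounded bounded_pos by (smt (verit) SigmaI case_prod_conv imageI)
  have der: "(q has_vector_derivative F t (q t)) (at t within {a..<b})" if "t \<in> {a..<b}" for t
    using q that by (auto simp: solution_on_def)
  have "M-lipschitz_on {a..<b} q"
  proof (rule lipschitz_onI)
    fix s t assume st: "s \<in> {a..<b}" "t \<in> {a..<b}"
    have "norm (q s - q t) \<le> M * norm (s - t)"
    proof (rule differentiable_bound[of "{a..<b}"])
      show "convex {a..<b}" by (simp add: convex_real_interval)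
      show "(q has_derivative (\<lambda>h. h *\<^sub>R F u (q u))) (at u within {a..<b})" if "u \<in> {a..<b}" for u
        using der[OF that] by (simp add: has_vector_derivative_def)
      show "onorm (\<lambda>h. h *\<^sub>R F u (q u)) \<le> M" if "u \<in> {a..<b}" for u
        by (rule onorm_le) (use M(2)[of u "q u"] that K(3)[OF that] in \<open>auto simp: mult.commute[of M] intro: mult_left_mono\<close>)
    qed (use st in auto)
    then show "dist (q s) (q t) \<le> M * dist s t" by (simp add: dist_norm)
  qed (use M in auto)
  then have "uniformly_continuous_on {a..<b} q" by (rule lipschitz_on_uniformly_continuous)
  then obtain g where g: "uniformly_continuous_on (closure {a..<b}) g" "\<And>x. x \<in> {a..<b} \<Longrightarrow> q x = g x"
    by (rule uniformly_continuous_on_extension_on_closure) blast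
  have cl: "closure {a..<b} = {a..b}" using \<open>a < b\<close> by simp
  have cg: "continuous_on {a..b} g" using g(1) cl uniformly_continuous_imp_continuous by metis
  have gK: "g t \<in> K" if "t \<in> {a..b}" for t
  proof -
    have "g ` closure {a..<b} \<subseteq> K"
      by (rule image_closure_subset) (use cg cl K g in \<open>auto simp: compact_imp_closed\<close>)
    then show ?thesis using that cl by auto
  qed
  have cF: "continuous_on {a..b} (\<lambda>s. F s (g s))"
  proof -
    have "continuous_on {a..b} ((\<lambda>(t, x). F t x) \<circ> (\<lambda>s. (s, g s)))"
      by (intro continuous_on_compose continuous_intros cg continuous_on_subset[OF cont])
        (use gK K in auto)
    then show ?thesis by (simp add: o_def)
  qed
  \<comment> \<open>Defect of the integral equation: it vanishes before \<open>b\<close>, hence by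
    continuity also at \<open>b\<close>.\<close>
  define e where "e = (\<lambda>t. g t - g a - integral {a..t} (\<lambda>s. F s (g s)))"
  have e0: "e t = 0" if t: "t \<in> {a..<b}" for t
  proof -
    have "((\<lambda>s. F s (g s)) has_integral (q t - q a)) {a..t}"
    proof (rule fundamental_theorem_of_calculus)
      show "a \<le> t" using t by auto
      fix s assume s: "s \<in> {a..t}"
      then have "(q has_vector_derivative F s (q s)) (at s within {a..t})"
        using t by (intro has_vector_derivative_within_subset[OF der]) auto
      then show "(q has_vector_derivative F s (g s)) (at s within {a..t})" using g(2)[of s] s t by auto
    qed
    then show ?thesis using g(2)[of t] g(2)[of a] t by (auto simp: e_def integral_unique)
  qed
  have e: "e t = 0" if "t \<in> {a..b}" for t
  proof -
    have "continuous_on (closure {a..<b}) e" unfolding e_def cl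
      by (intro continuous_intros cg indefinite_integral_continuous_1 integrable_continuous_real cF)
    then show ?thesis by (rule continuous_constant_on_closure) (use e0 that cl in auto)
  qed
  show thesis
  proof
    show "solution_on F \<Omega> {a..b} g" unfolding solution_on_def
    proof (intro ballI conjI)
      fix t assume t: "t \<in> {a..b}"
      show "g t \<in> \<Omega>" using gK[OF t] K by auto
      have "((\<lambda>u. g a + integral {a..u} (\<lambda>s. F s (g s))) has_vector_derivative F t (g t)) (at t within {a..b})"
        using integral_has_vector_derivative[OF cF t] by (auto intro!: derivative_eq_intros)
      then show "(g has_vector_derivative F t (g t)) (at t within {a..b})"
      proof (rule has_vector_derivative_transform[OF t, rotated])
        fix s assume "s \<in> {a..b}"
        then show "g s = g a + integral {a..s} (\<lambda>s. F s (g s))"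
          using e[of s] unfolding e_def by (metis diff_diff_add right_minus_eq)
      qed
    qed
    show "g t = q t" if "t \<in> {a..<b}" for t using g(2)[OF that] by simp
  qed
qed

text \<open>Whether the supremum exists and is attained decides the shape; the degenerate interval
  is the case \<open>b = a\<close>.\<close>

lemma interval_cases_from_left:
  fixes I :: "real set"
  assumes "is_interval I" "a \<in> I" "I \<subseteq> {a..}"
  shows "I = {a..} \<or> (\<exists>b\<ge>a. I = {a..b}) \<or> (\<exists>b>a. I = {a..<b})"
proof (cases "bdd_above I")
  case False
  have "x \<in> I" if x: "x \<ge> a" for x
  proof -
    obtain y where "y \<in> I" "y > x" using False by (meson bdd_above.I leI)
    then show ?thesis using assms x mem_is_interval_1_I[of I a y x] by auto
  qed
  then show ?thesis using assms by auto
next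
  case True
  have sup: "x \<le> Sup I" if "x \<in> I" for x using True that cSup_upper by blast
  have lt: "x \<in> I" if x: "x \<ge> a" "x < Sup I" for x
  proof -
    obtain y where "y \<in> I" "y > x" using assms(2) x less_cSup_iff[of I x] True by auto
    then show ?thesis using assms x mem_is_interval_1_I[of I a y x] by auto
  qed
  show ?thesis
  proof (cases "Sup I \<in> I")
    case True
    then have "I = {a..Sup I}" using sup lt assms(3) by (auto simp: less_eq_real_def)
    then show ?thesis using sup[OF assms(2)] by blast
  next
    case False
    have "x \<in> I \<longleftrightarrow> x \<in> {a..<Sup I}" for x
      using sup[of x] lt[of x] assms(3) False by (cases "x = Sup I") auto
    then have "I = {a..<Sup I}" by blast
    moreover have "a < Sup I" using False sup[OF assms(2)] assms(2) by (metis less_eq_real_def)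
    ultimately show ?thesis by blast
  qed
qed

text \<open>To a closed bounded interval a local solution could be appended, to a half-open one its
  endpoint could be added; both contradict maximality.\<close>

lemma maximal_solution_global:
  fixes F :: "real \<Rightarrow> 'a::euclidean_space \<Rightarrow> 'a"
  assumes cont: "continuous_on (UNIV \<times> \<Omega>) (\<lambda>(t, x). F t x)"
    and lip: "local_lipschitz UNIV \<Omega> F" and "open \<Omega>"
    and max: "maximal_solution F \<Omega> t0 I q"
    and K: "compact K" "K \<subseteq> \<Omega>" "\<And>t. t \<in> I \<Longrightarrow> q t \<in> K"
  shows "I = {t0..}"
proof -
  have I: "is_interval I" "t0 \<in> I" "I \<subseteq> {t0..}" and sol: "solution_on F \<Omega> I q"
    using max by (auto simp: maximal_solution_def)
  have noext: "J = I" if "is_interval J" "I \<subseteq> J" "J \<subseteq> {t0..}" "solution_on F \<Omega> J g" "\<And>t. t \<in> I \<Longrightarrow> g t = q t" for J g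
    using max that unfolding maximal_solution_def by blast
  have False if b: "b \<ge> t0" "I = {t0..b}" for b
  proof -
    have "q b \<in> \<Omega>" using K b by auto
    then obtain h g where hg: "h > 0" "g b = q b" "solution_on F \<Omega> {b..b+h} g"
      using picard_local_existence[OF cont lip \<open>open \<Omega>\<close>] by metis
    have "solution_on F \<Omega> {t0..b+h} (\<lambda>t. if t \<in> {t0..b} then q t else g t)"
      by (rule solution_on_append) (use hg sol b in auto)
    then have "{t0..b+h} = I" by (rule noext[rotated 3]) (use b hg in \<open>auto simp: is_interval_cc\<close>)
    then show False using b hg by auto
  qed
  moreover have False if b: "b > t0" "I = {t0..<b}" for b
  proof -
    obtain g where g: "solution_on F \<Omega> {t0..b} g" "\<And>t. t \<in> {t0..<b} \<Longrightarrow> g t = q t"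
      using solution_on_extend_right_endpoint[OF cont _ b(1) K(1,2), of q] sol K(3) b(2) by metis
    have "{t0..b} = I" by (rule noext[OF _ _ _ g(1)]) (use b g in \<open>auto simp: is_interval_cc\<close>)
    moreover have "b \<in> {t0..b}" "b \<notin> I" using b by auto
    ultimately show False by blast
  qed
  ultimately show ?thesis using interval_cases_from_left[OF I] by blast
qed

section \<open>Averaging by a near-identity transformation\<close>

definition resonance :: "('j \<Rightarrow> real) \<Rightarrow> ('j \<Rightarrow> real) \<Rightarrow> 'j \<Rightarrow> 'j \<Rightarrow> real" where
  "resonance w \<theta> j l = (if w j = w l then sin (\<theta> l - \<theta> j) / (2 * w j) else 0)"

text \<open>A bounded primitive of the zero-mean part of \<open>sin (w j * \<tau> - \<theta> j) / w j * cos (w l * \<tau> - \<theta> l)\<close>,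
  whose mean is \<open>resonance w \<theta> j l\<close>; for \<open>w j = w l\<close> the second summand vanishes because \<open>x / 0 = 0\<close>.\<close>

definition beat :: "('j \<Rightarrow> real) \<Rightarrow> ('j \<Rightarrow> real) \<Rightarrow> 'j \<Rightarrow> 'j \<Rightarrow> real \<Rightarrow> real" where
  "beat w \<theta> j l \<tau> = - (cos ((w j + w l) * \<tau> - (\<theta> j + \<theta> l)) / (w j + w l)
     + cos ((w j - w l) * \<tau> - (\<theta> j - \<theta> l)) / (w j - w l)) / (2 * w j)"

lemma beat_has_derivative:
  assumes "w j > 0" "w l > 0"
  shows "(beat w \<theta> j l has_real_derivative
     sin (w j * \<tau> - \<theta> j) / w j * cos (w l * \<tau> - \<theta> l) - resonance w \<theta> j l) (at \<tau>)"
proof -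
  have prod: "sin (w j * \<tau> - \<theta> j) * cos (w l * \<tau> - \<theta> l)
      = (sin ((w j + w l) * \<tau> - (\<theta> j + \<theta> l)) + sin ((w j - w l) * \<tau> - (\<theta> j - \<theta> l))) / 2"
  proof -
    have "(w j * \<tau> - \<theta> j) + (w l * \<tau> - \<theta> l) = (w j + w l) * \<tau> - (\<theta> j + \<theta> l)"
      "(w j * \<tau> - \<theta> j) - (w l * \<tau> - \<theta> l) = (w j - w l) * \<tau> - (\<theta> j - \<theta> l)"
      by (auto simp: algebra_simps)
    then show ?thesis using sin_times_cos[of "w j * \<tau> - \<theta> j" "w l * \<tau> - \<theta> l"] by (simp only:)
  qed
  \<comment> \<open>For \<open>a = 0\<close> the quotient is the constant 0, so the constant part of
    the product is left over; it is the mean \<open>resonance w \<theta> j l\<close>.\<close>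
  have cos': "((\<lambda>\<tau>. cos (a * \<tau> - b) / a) has_real_derivative (if a = 0 then 0 else - sin (a * \<tau> - b))) (at \<tau>)"
    for a b \<tau> :: real
    by (cases "a = 0") (auto intro!: derivative_eq_intros)
  have "(beat w \<theta> j l has_real_derivative
      - ((if w j + w l = 0 then 0 else - sin ((w j + w l) * \<tau> - (\<theta> j + \<theta> l)))
       + (if w j - w l = 0 then 0 else - sin ((w j - w l) * \<tau> - (\<theta> j - \<theta> l)))) / (2 * w j)) (at \<tau>)"
    unfolding beat_def[abs_def] by (intro DERIV_cdivide DERIV_minus DERIV_add cos')
  moreover have "- ((if w j + w l = 0 then 0 else - sin ((w j + w l) * \<tau> - (\<theta> j + \<theta> l)))
       + (if w j - w l = 0 then 0 else - sin ((w j - w l) * \<tau> - (\<theta> j - \<theta> l)))) / (2 * w j) = sin (w j * \<tau> - \<theta> j) / w j * cos (w l * \<tau> - \<theta> l) - resonance w \<theta> j l"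
    using assms prod by (cases "w j = w l") (auto simp: resonance_def field_simps)
  ultimately show ?thesis by simp
qed

lemma beat_bounded: obtains B where "B \<ge> 0" "\<And>(j::'j::finite) l \<tau>. \<bar>beat w \<theta> j l \<tau>\<bar> \<le> B"
proof -
  \<comment> \<open>Here, too, \<open>1 / 0 = 0\<close>, matching the vanishing second summand of
    \<open>beat\<close> at equal frequencies.\<close>
  define b where "b = (\<lambda>(j, l). (1 / \<bar>w j + w l\<bar> + 1 / \<bar>w j - w l\<bar>) / (2 * \<bar>w j\<bar>))"
  have b: "\<bar>beat w \<theta> j l \<tau>\<bar> \<le> b (j, l)" for j l \<tau>
  proof -
    have "\<bar>cos ((w j + w l) * \<tau> - (\<theta> j + \<theta> l)) / (w j + w l)\<bar> \<le> 1 / \<bar>w j + w l\<bar>"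
      "\<bar>cos ((w j - w l) * \<tau> - (\<theta> j - \<theta> l)) / (w j - w l)\<bar> \<le> 1 / \<bar>w j - w l\<bar>"
      by (auto simp: abs_divide intro!: divide_right_mono)
    then have "\<bar>cos ((w j + w l) * \<tau> - (\<theta> j + \<theta> l)) / (w j + w l)
     + cos ((w j - w l) * \<tau> - (\<theta> j - \<theta> l)) / (w j - w l)\<bar> \<le> 1 / \<bar>w j + w l\<bar> + 1 / \<bar>w j - w l\<bar>" by linarith
    then show ?thesis unfolding beat_def b_def by (simp add: abs_mult divide_right_mono abs_divide)
  qed
  have b0: "b p \<ge> 0" for p by (auto simp: b_def split: prod.split)
  show thesis
  proof
    show "sum b UNIV \<ge> 0" using b0 by (simp add: sum_nonneg)
    show "\<bar>beat w \<theta> j l \<tau>\<bar> \<le> sum b UNIV" for j l \<tau>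
      using b[of j l \<tau>] member_le_sum[of "(j, l)" UNIV b] b0 by fastforce
  qed
qed

text \<open>The first sum is the primitive of the dithers with frozen state. Differentiated along a
  solution, it leaves the terms \<open>- sin (w j * \<tau> - \<theta> j) / w j * cos (w l * \<tau> -
  \<theta> l)\<close> times \<open>g' j x (g l x)\<close>, where
  \<open>\<tau> = \<omega> * t\<close>; the second sum cancels their zero-mean part.\<close>

definition near_identity ::
  "('j::finite \<Rightarrow> real) \<Rightarrow> ('j \<Rightarrow> real) \<Rightarrow> ('j \<Rightarrow> 'a::real_normed_vector \<Rightarrow> 'a) \<Rightarrow>
   ('j \<Rightarrow> 'a \<Rightarrow> 'a \<Rightarrow>\<^sub>L 'a) \<Rightarrow> real \<Rightarrow> real \<Rightarrow> 'a \<Rightarrow> 'a" where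
  "near_identity w \<theta> g g' \<omega> t x = x
     - (1 / sqrt \<omega>) *\<^sub>R (\<Sum>j\<in>UNIV. (sin (w j * (\<omega> * t) - \<theta> j) / w j) *\<^sub>R g j x)
     + (1 / \<omega>) *\<^sub>R (\<Sum>j\<in>UNIV. \<Sum>l\<in>UNIV. beat w \<theta> j l (\<omega> * t) *\<^sub>R g' j x (g l x))"

text \<open>\<open>g' j x (g l x)\<close> is the derivative of \<open>g j\<close> along
  \<open>g l\<close>. As \<open>resonance\<close> is antisymmetric in \<open>j\<close> and
  \<open>l\<close>, the double sum consists of Lie brackets.\<close>

definition averaged_field ::
  "('j::finite \<Rightarrow> real) \<Rightarrow> ('j \<Rightarrow> real) \<Rightarrow> ('a \<Rightarrow> 'a) \<Rightarrow> ('j \<Rightarrow> 'a::real_normed_vector \<Rightarrow> 'a) \<Rightarrow>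
   ('j \<Rightarrow> 'a \<Rightarrow> 'a \<Rightarrow>\<^sub>L 'a) \<Rightarrow> 'a \<Rightarrow> 'a" where
  "averaged_field w \<theta> f g g' x =
     f x - (\<Sum>j\<in>UNIV. \<Sum>l\<in>UNIV. resonance w \<theta> j l *\<^sub>R g' j x (g l x))"

definition oscillating_field ::
  "('j::finite \<Rightarrow> real) \<Rightarrow> ('j \<Rightarrow> real) \<Rightarrow> ('a \<Rightarrow> 'a) \<Rightarrow> ('j \<Rightarrow> 'a::real_normed_vector \<Rightarrow> 'a) \<Rightarrow>
   real \<Rightarrow> real \<Rightarrow> 'a \<Rightarrow> 'a" where
  "oscillating_field w \<theta> f g \<omega> t x =
     f x + sqrt \<omega> *\<^sub>R (\<Sum>j\<in>UNIV. cos (w j * (\<omega> * t) - \<theta> j) *\<^sub>R g j x)"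

lemma norm_sum_scaleR_le:
  fixes v :: "'j::finite \<Rightarrow> 'a::real_normed_vector"
  assumes "\<And>j. \<bar>c j\<bar> \<le> A" "\<And>j. norm (v j) \<le> M" "0 \<le> A"
  shows "norm (\<Sum>j\<in>UNIV. c j *\<^sub>R v j) \<le> real CARD('j) * (A * M)"
proof -
  have "norm (c j *\<^sub>R v j) \<le> A * M" for j using assms by (auto intro: mult_mono)
  then show ?thesis using sum_norm_bound[of UNIV "\<lambda>j. c j *\<^sub>R v j" "A * M"] by simp
qed

lemma continuous_family_bounded:
  fixes h :: "'j::finite \<Rightarrow> 'a::topological_space \<Rightarrow> 'b::real_normed_vector"
  assumes "compact K" "\<And>j. continuous_on K (h j)"
  obtains B where "B \<ge> 0" "\<And>j x. x \<in> K \<Longrightarrow> norm (h j x) \<le> B"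
proof -
  have "bounded (\<Union>j. h j ` K)"
    using assms by (intro bounded_UN finite ballI compact_imp_bounded compact_continuous_image) auto
  then obtain B where "B > 0" "\<And>y. y \<in> (\<Union>j. h j ` K) \<Longrightarrow> norm y \<le> B" using bounded_pos by metis
  then show thesis using that[of B] by auto
qed

text \<open>Only bounds on the compact set \<open>K\<close> and on the bounded oscillations enter,
  so one constant serves all \<open>t\<close> and all \<open>\<omega> \<ge> 1\<close>. The second
  correction contains \<open>g' j x (g l x)\<close>, hence this product must be differentiable once
  more. The derivative is compared with the averaged field at \<open>q t\<close>, not yet at the
  transformed point.\<close>

lemma near_identity_estimates:
  fixes g :: "'j::finite \<Rightarrow> 'a::euclidean_space \<Rightarrow> 'a"
    and g' :: "'j \<Rightarrow> 'a \<Rightarrow> 'a \<Rightarrow>\<^sub>L 'a" and c' :: "'j \<Rightarrow> 'j \<Rightarrow> 'a \<Rightarrow> 'a \<Rightarrow>\<^sub>L 'a"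
  assumes K: "compact K" and cf: "continuous_on K f"
    and dg: "\<And>j x. x \<in> K \<Longrightarrow> (g j has_derivative g' j x) (at x)" and cg': "\<And>j. continuous_on K (g' j)"
    and dc: "\<And>j l x. x \<in> K \<Longrightarrow> ((\<lambda>x. g' j x (g l x)) has_derivative c' j l x) (at x)"
    and cc': "\<And>j l. continuous_on K (c' j l)"
    and w: "\<And>j. w j > 0"
  obtains C where "C \<ge> 0"
    "\<And>\<omega> t x. \<omega> \<ge> 1 \<Longrightarrow> x \<in> K \<Longrightarrow> norm (near_identity w \<theta> g g' \<omega> t x - x) \<le> C / sqrt \<omega>"
    "\<And>\<omega> I q t. \<omega> \<ge> 1 \<Longrightarrow> q t \<in> K \<Longrightarrow>
       (q has_vector_derivative oscillating_field w \<theta> f g \<omega> t (q t)) (at t within I) \<Longrightarrow>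
       \<exists>d. ((\<lambda>s. near_identity w \<theta> g g' \<omega> s (q s)) has_vector_derivative d) (at t within I) \<and>
           norm (d - averaged_field w \<theta> f g g' (q t)) \<le> C / sqrt \<omega>"
proof -
  have cg: "continuous_on K (g j)" for j
    using dg has_derivative_continuous continuous_at_imp_continuous_on by blast
  obtain B1 where B1: "B1 \<ge> 0" "\<And>j x. x \<in> K \<Longrightarrow> norm (g j x) \<le> B1"
    using continuous_family_bounded[of K g, OF K cg] by metis
  obtain B2 where B2: "B2 \<ge> 0" "\<And>j x. x \<in> K \<Longrightarrow> norm (g' j x) \<le> B2"
    using continuous_family_bounded[of K g', OF K cg'] by metis
  obtain B3 where B3: "B3 \<ge> 0" "\<And>j l x. x \<in> K \<Longrightarrow> norm (c' j l x) \<le> B3"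
  proof -
    have "continuous_on K (case p of (j, l) \<Rightarrow> c' j l)" for p using cc' by (cases p) auto
    then show ?thesis using continuous_family_bounded[of K "\<lambda>(j, l). c' j l", OF K] that by (metis case_prod_conv)
  qed
  obtain B0 where B0: "B0 \<ge> 0" "\<And>x. x \<in> K \<Longrightarrow> norm (f x) \<le> B0"
    using continuous_family_bounded[of K "\<lambda>_::unit. f", OF K cf] by metis
  obtain B4 where B4: "B4 \<ge> 0" "\<And>j l \<tau>. \<bar>beat w \<theta> j l \<tau>\<bar> \<le> B4"
    using beat_bounded[of w \<theta>] by metis
  define W where "W = (\<Sum>j\<in>UNIV. 1 / w j)"
  have W: "\<bar>sin s / w j\<bar> \<le> W" for s j
  proof -
    have "\<bar>sin s / w j\<bar> \<le> 1 / w j" using w[of j] by (simp add: abs_divide divide_right_mono)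
    also have "\<dots> \<le> W" unfolding W_def using w by (intro member_le_sum) (auto simp: less_imp_le)
    finally show ?thesis .
  qed
  have W0: "W \<ge> 0" using W[of 0] by fastforce
  let ?N = "real CARD('j)"
  have g'g: "norm (blinfun_apply (g' j x) v) \<le> B2 * M" if "x \<in> K" "norm v \<le> M" for j x v M
    using norm_blinfun[of "g' j x" v] B2 that by (meson mult_mono norm_ge_zero order_trans)
  have c'g: "norm (blinfun_apply (c' j l x) v) \<le> B3 * M" if "x \<in> K" "norm v \<le> M" for j l x v M
    using norm_blinfun[of "c' j l x" v] B3 that by (meson mult_mono norm_ge_zero order_trans)
  \<comment> \<open>\<open>C1\<close> bounds the two corrections, \<open>C2\<close> the remainders
    \<open>R1\<close> and \<open>R2\<close> below.\<close>
  define C1 where "C1 = ?N * (W * B1) + ?N * (1 * (?N * (B4 * (B2 * B1))))"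
  define C2 where "C2 = ?N * (W * (B2 * B0)) + ?N * (1 * (?N * (B4 * (B3 * (B0 + ?N * (1 * B1))))))"
  have C0: "C1 \<ge> 0" "C2 \<ge> 0" unfolding C1_def C2_def using W0 B0 B1 B2 B3 B4 by auto
  have le_div: "a \<le> D / sqrt \<omega>" if "a \<le> D' / sqrt \<omega>" "D' \<le> D" "\<omega> \<ge> 1" for a D D' \<omega> :: real
    using that by (meson divide_right_mono order_trans real_sqrt_ge_zero le_numeral_extra(1) order.trans zero_le_one)
  have inv\<omega>: "1 / \<omega> \<le> 1 / sqrt \<omega>" if "\<omega> \<ge> 1" for \<omega> :: real
    using that by (intro divide_left_mono) (auto simp: real_sqrt_le_iff sqrt_le_D real_le_lsqrt power2_eq_square)
  show thesis
  proof
    show "max C1 C2 \<ge> 0" using C0 by simp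
  next
    fix \<omega> t :: real and x assume \<omega>: "\<omega> \<ge> 1" and x: "x \<in> K"
    let ?S1 = "\<Sum>j\<in>UNIV. (sin (w j * (\<omega> * t) - \<theta> j) / w j) *\<^sub>R g j x"
    \<comment> \<open>The factor 1 makes the outer sum an instance of
      \<open>norm_sum_scaleR_le\<close> as well.\<close>
    let ?S2 = "\<Sum>j\<in>UNIV. 1 *\<^sub>R (\<Sum>l\<in>UNIV. beat w \<theta> j l (\<omega> * t) *\<^sub>R g' j x (g l x))"
    have 1: "norm ?S1 \<le> ?N * (W * B1)" by (intro norm_sum_scaleR_le W B1 x W0)
    have 2: "norm ?S2 \<le> ?N * (1 * (?N * (B4 * (B2 * B1))))"
      by (intro norm_sum_scaleR_le B4 g'g B1 x) auto
    have "norm (near_identity w \<theta> g g' \<omega> t x - x) = norm ((1 / \<omega>) *\<^sub>R ?S2 - (1 / sqrt \<omega>) *\<^sub>R ?S1)"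
      by (simp add: near_identity_def)
    also have "\<dots> \<le> (1 / \<omega>) * norm ?S2 + (1 / sqrt \<omega>) * norm ?S1"
      using \<omega> norm_triangle_ineq4[of "(1 / \<omega>) *\<^sub>R ?S2" "(1 / sqrt \<omega>) *\<^sub>R ?S1"] by simp
    also have "\<dots> \<le> (1 / sqrt \<omega>) * norm ?S2 + (1 / sqrt \<omega>) * norm ?S1"
      using inv\<omega>[OF \<omega>] by (intro add_mono mult_right_mono) auto
    also have "\<dots> \<le> C1 / sqrt \<omega>"
    proof -
      have "(1 / sqrt \<omega>) * (norm ?S2 + norm ?S1) \<le> (1 / sqrt \<omega>) * C1"
        using 1 2 \<omega> unfolding C1_def by (intro mult_left_mono) auto
      then show ?thesis by (simp add: algebra_simps)
    qed
    finally show "norm (near_identity w \<theta> g g' \<omega> t x - x) \<le> max C1 C2 / sqrt \<omega>"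
      using le_div[OF _ _ \<omega>] by (meson max.cobounded1)
  next
    fix \<omega> t :: real and I and q :: "real \<Rightarrow> 'a"
    assume \<omega>: "\<omega> \<ge> 1" and qK: "q t \<in> K"
    define u where "u = (\<lambda>j. cos (w j * (\<omega> * t) - \<theta> j))"
    define U where "U = (\<lambda>j. sin (w j * (\<omega> * t) - \<theta> j) / w j)"
    define Ph where "Ph = (\<lambda>j l. beat w \<theta> j l (\<omega> * t))"
    define x where "x = q t"
    define c where "c = (\<lambda>j l. blinfun_apply (g' j x) (g l x))"
    define p where "p = oscillating_field w \<theta> f g \<omega> t x"
    assume "(q has_vector_derivative oscillating_field w \<theta> f g \<omega> t (q t)) (at t within I)"
    then have q': "(q has_vector_derivative p) (at t within I)" by (simp add: p_def x_def)
    have x: "x \<in> K" using qK by (simp add: x_def)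
    have p: "p = f x + sqrt \<omega> *\<^sub>R (\<Sum>j\<in>UNIV. u j *\<^sub>R g j x)" by (simp add: p_def u_def oscillating_field_def)
    have gq: "((\<lambda>s. g j (q s)) has_vector_derivative g' j x p) (at t within I)" for j
      using vector_derivative_diff_chain_within[OF q' has_derivative_at_withinI[OF dg[OF qK]], of j]
      by (simp add: o_def x_def)
    have cq: "((\<lambda>s. g' j (q s) (g l (q s))) has_vector_derivative c' j l x p) (at t within I)" for j l
      using vector_derivative_diff_chain_within[OF q' has_derivative_at_withinI[OF dc[OF qK]], of j l]
      by (simp add: o_def x_def)
    have U': "((\<lambda>s. sin (w j * (\<omega> * s) - \<theta> j) / w j) has_real_derivative \<omega> * u j) (at t within I)" for j
      using w[of j] by (auto intro!: derivative_eq_intros simp: u_def)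
    have Ph': "((\<lambda>s. beat w \<theta> j l (\<omega> * s)) has_real_derivative \<omega> * (U j * u l - resonance w \<theta> j l)) (at t within I)" for j l
      using DERIV_chain2[where g = "\<lambda>s. \<omega> * s" and x = t, OF beat_has_derivative[of w j l \<theta> "\<omega> * t", OF w w], OF DERIV_cmult_Id]
      by (simp add: u_def U_def mult.commute)
    define d where "d = p - (1 / sqrt \<omega>) *\<^sub>R (\<Sum>j\<in>UNIV. U j *\<^sub>R g' j x p + (\<omega> * u j) *\<^sub>R g j x)
       + (1 / \<omega>) *\<^sub>R (\<Sum>j\<in>UNIV. \<Sum>l\<in>UNIV. Ph j l *\<^sub>R c' j l x p + (\<omega> * (U j * u l - resonance w \<theta> j l)) *\<^sub>R c j l)"
    have der: "((\<lambda>s. near_identity w \<theta> g g' \<omega> s (q s)) has_vector_derivative d) (at t within I)"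
      unfolding near_identity_def d_def U_def Ph_def c_def x_def
      by (intro has_vector_derivative_add has_vector_derivative_diff q'[unfolded x_def] has_vector_derivative_sum
          bounded_linear.has_vector_derivative[OF bounded_linear_scaleR_right]
          has_vector_derivative_scaleR gq[unfolded x_def] cq[unfolded x_def] U'
          Ph'[unfolded U_def])
    \<comment> \<open>\<open>R1\<close> stems from the drift entering the first correction,
      \<open>R2\<close> from the moving coefficients of the second. Since \<open>p\<close> has size
      \<open>sqrt \<omega>\<close>, its rescaling in \<open>R2\<close> is bounded.\<close>
    define R1 where "R1 = (\<Sum>j\<in>UNIV. U j *\<^sub>R g' j x (f x))"
    define R2 where "R2 = (\<Sum>j\<in>UNIV. 1 *\<^sub>R (\<Sum>l\<in>UNIV. Ph j l *\<^sub>R c' j l x ((1 / sqrt \<omega>) *\<^sub>R p)))"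
    have s: "sqrt \<omega> > 0" "\<omega> = sqrt \<omega> * sqrt \<omega>" using \<omega> by auto
    have ss: "sqrt \<omega> * (sqrt \<omega> * a) = \<omega> * a" for a using s(2) by (metis mult.assoc)
    \<comment> \<open>By \<open>b\<close> the dithers of order \<open>sqrt \<omega>\<close> cancel
      and \<open>p\<close> shrinks to \<open>f x\<close>; the products \<open>U j * u l\<close> of
      order one cancel between \<open>a\<close> and \<open>e\<close>, leaving the
      resonances.\<close>
    have d: "d - averaged_field w \<theta> f g g' x = (1 / sqrt \<omega>) *\<^sub>R (R2 - R1)"
    proof -
      have a: "(\<Sum>j\<in>UNIV. U j *\<^sub>R g' j x p) = R1 + sqrt \<omega> *\<^sub>R (\<Sum>j\<in>UNIV. \<Sum>l\<in>UNIV. (U j * u l) *\<^sub>R c j l)"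
        unfolding R1_def p c_def
        by (simp add: blinfun.bilinear_simps scaleR_sum_right sum.distrib scaleR_add_right algebra_simps)
      have b: "(\<Sum>j\<in>UNIV. (\<omega> * u j) *\<^sub>R g j x) = sqrt \<omega> *\<^sub>R (p - f x)"
        unfolding p by (simp add: scaleR_sum_right ss)
      have c: "(\<Sum>j\<in>UNIV. \<Sum>l\<in>UNIV. Ph j l *\<^sub>R c' j l x p) = sqrt \<omega> *\<^sub>R R2"
        unfolding R2_def using s(1) by (simp add: blinfun.bilinear_simps scaleR_sum_right)
      have e: "(\<Sum>j\<in>UNIV. \<Sum>l\<in>UNIV. (\<omega> * (U j * u l - resonance w \<theta> j l)) *\<^sub>R c j l)
         = \<omega> *\<^sub>R ((\<Sum>j\<in>UNIV. \<Sum>l\<in>UNIV. (U j * u l) *\<^sub>R c j l) - (\<Sum>j\<in>UNIV. \<Sum>l\<in>UNIV. resonance w \<theta> j l *\<^sub>R c j l))"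
        by (simp add: scaleR_sum_right algebra_simps sum_subtractf)
      have av: "averaged_field w \<theta> f g g' x = f x - (\<Sum>j\<in>UNIV. \<Sum>l\<in>UNIV. resonance w \<theta> j l *\<^sub>R c j l)"
        by (simp add: averaged_field_def c_def)
      have i: "sqrt \<omega> / \<omega> = 1 / sqrt \<omega>" using s by (metis divide_divide_eq_left div_self order_less_irrefl)
      show ?thesis unfolding d_def sum.distrib a b c e av
        using s(1) \<omega> by (simp add: scaleR_add_right scaleR_diff_right i)
    qed
    have "norm R1 \<le> ?N * (W * (B2 * B0))" unfolding R1_def U_def
      by (intro norm_sum_scaleR_le W W0 g'g B0 x)
    moreover have "norm R2 \<le> ?N * (1 * (?N * (B4 * (B3 * (B0 + ?N * (1 * B1))))))" unfolding R2_def Ph_def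
    proof (intro norm_sum_scaleR_le B4 c'g x)
      have "(1 / sqrt \<omega>) *\<^sub>R p = (1 / sqrt \<omega>) *\<^sub>R f x + (\<Sum>j\<in>UNIV. u j *\<^sub>R g j x)"
        using s by (simp add: p scaleR_add_right)
      also have "norm \<dots> \<le> 1 * B0 + ?N * (1 * B1)"
      proof (intro norm_triangle_mono norm_sum_scaleR_le B1 x)
        have "1 / sqrt \<omega> * norm (f x) \<le> 1 * B0"
          using \<omega> B0 x by (intro mult_mono) auto
        then show "norm ((1 / sqrt \<omega>) *\<^sub>R f x) \<le> 1 * B0" using s by simp
      qed (auto simp: u_def)
      finally show "norm ((1 / sqrt \<omega>) *\<^sub>R p) \<le> B0 + ?N * (1 * B1)" by simp
    qed auto
    ultimately have "norm (R2 - R1) \<le> C2" unfolding C2_def using norm_triangle_ineq4[of R2 R1] by linarith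
    then have "norm (d - averaged_field w \<theta> f g g' x) \<le> C2 / sqrt \<omega>"
      unfolding d using s by (simp add: divide_right_mono)
    then have "norm (d - averaged_field w \<theta> f g g' (q t)) \<le> max C1 C2 / sqrt \<omega>"
      unfolding x_def by (rule le_div[OF _ _ \<omega>]) simp
    then show "\<exists>d. ((\<lambda>s. near_identity w \<theta> g g' \<omega> s (q s)) has_vector_derivative d) (at t within I) \<and>
           norm (d - averaged_field w \<theta> f g g' (q t)) \<le> max C1 C2 / sqrt \<omega>" using der by blast
  qed
qed

section \<open>Practical stability from a Lyapunov function of the averaged system\<close>

text \<open>After the last time with \<open>u \<le> m\<close> the mean value theorem gives slope at
  most \<open>- p\<close>, so \<open>u\<close> cannot climb above \<open>m\<close> again; without
  such a time \<open>u\<close> decreases at rate \<open>p\<close> from \<open>u a\<close>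
  on.\<close>

lemma upper_comparison:
  fixes u :: "real \<Rightarrow> real"
  assumes der: "\<And>t. t \<in> {a..b} \<Longrightarrow> (u has_real_derivative u' t) (at t within {a..b})"
    and dec: "\<And>t. t \<in> {a..b} \<Longrightarrow> u t \<ge> m \<Longrightarrow> u' t \<le> - p" and "p \<ge> 0" and t: "t \<in> {a..b}"
  shows "u t \<le> max m (u a - p * (t - a))"
proof (rule ccontr)
  assume "\<not> ?thesis"
  then have ut: "u t > m" "u t > u a - p * (t - a)" by auto
  have cont: "continuous_on {a..b} u"
    unfolding continuous_on_eq_continuous_within by (meson der DERIV_continuous)
  have step: "u t \<le> u s - p * (t - s)" if s: "s \<in> {a..t}" and above: "\<And>r. r \<in> {s<..<t} \<Longrightarrow> u r \<ge> m" for s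
  proof (cases "s = t")
    case False
    then have "s < t" using s by simp
    have d: "(u has_derivative (*) (u' r)) (at r)" if "s < r" "r < t" for r
    proof -
      have "at r within {a..b} = at r" using that s t by (intro at_within_Icc_at) auto
      then show ?thesis using der[of r] that s t by (auto simp: has_field_derivative_def)
    qed
    obtain r where r: "s < r" "r < t" "u t - u s = u' r * (t - s)"
      using mvt[OF \<open>s < t\<close> continuous_on_subset[OF cont] d] s t by auto
    have "u' r \<le> - p" using dec[of r] above[of r] r s t by auto
    then have "u' r * (t - s) \<le> - p * (t - s)" using \<open>s < t\<close> by (intro mult_right_mono) auto
    then show ?thesis using r by simp
  qed simp
  show False
  proof (cases "\<exists>s\<in>{a..t}. u s \<le> m")
    case False
    have "u r \<ge> m" if "r \<in> {a<..<t}" for r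
    proof -
      have "r \<in> {a..t}" using that by auto
      then show ?thesis using False by (meson linear)
    qed
    then have "u t \<le> u a - p * (t - a)" using t by (intro step) auto
    then show False using ut by simp
  next
    case True
    define A where "A = {a..t} \<inter> u -` {..m}"
    have "closed A" unfolding A_def
      by (intro continuous_closed_preimage continuous_on_subset[OF cont]) (use t in auto)
    moreover have "A \<noteq> {}" "bdd_above A" using True by (auto simp: A_def)
    ultimately have S: "Sup A \<in> A" by (rule closed_contains_Sup[rotated 2])
    have "u r \<ge> m" if "r \<in> {Sup A<..<t}" for r
    proof (rule ccontr)
      assume "\<not> u r \<ge> m"
      then have "r \<in> A" using that S by (auto simp: A_def)
      then show False using cSup_upper[OF _ \<open>bdd_above A\<close>] that by fastforce
    qed
    then have "u t \<le> u (Sup A) - p * (t - Sup A)" using S by (intro step) (auto simp: A_def)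
    also have "\<dots> \<le> u (Sup A)" using S \<open>p \<ge> 0\<close> by (auto simp: A_def)
    finally show False using S ut by (auto simp: A_def)
  qed
qed

lemma positive_lower_bound_on_compact:
  fixes f :: "'a::topological_space \<Rightarrow> real"
  assumes "compact A" "continuous_on A f" "\<And>x. x \<in> A \<Longrightarrow> f x > 0"
  obtains m where "m > 0" "\<And>x. x \<in> A \<Longrightarrow> m \<le> f x"
proof (cases "A = {}")
  case True
  then show thesis using that[of 1] by auto
next
  case False
  then obtain x where "x \<in> A" "\<And>y. y \<in> A \<Longrightarrow> f x \<le> f y" 
    using continuous_attains_inf[OF assms(1) _ assms(2)] by blast
  then show thesis using that[of "f x"] assms(3) by blast
qed

text \<open>The interface between averaging and the Lyapunov argument: \<open>z\<close> is an
  approximate trajectory of \<open>fbar\<close> for as long as \<open>q\<close> stays in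
  \<open>B\<close>. It includes \<open>z t \<in> S\<close> because positivity and decay of the
  Lyapunov function are available only there.\<close>

definition tracks_averaged ::
  "(real \<Rightarrow> 'a \<Rightarrow> 'a) \<Rightarrow> 'a::real_normed_vector set \<Rightarrow> 'a set \<Rightarrow> 'a set \<Rightarrow> ('a \<Rightarrow> 'a) \<Rightarrow> real \<Rightarrow> bool" where
  "tracks_averaged f \<Omega> S B fbar \<nu> \<longleftrightarrow>
     (\<forall>t0 T q. t0 \<le> T \<and> q t0 \<in> S \<and> solution_on f \<Omega> {t0..T} q \<and> (\<forall>t\<in>{t0..T}. q t \<in> B) \<longrightarrow>
        (\<exists>z z'. \<forall>t\<in>{t0..T}. z t \<in> S \<and> norm (z t - q t) \<le> \<nu> \<and>
           (z has_vector_derivative z' t) (at t within {t0..T}) \<and> norm (z' t - fbar (z t)) \<le> \<nu>))"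

text \<open>Solutions \<open>q\<close> are watched in the ball of radius \<open>r\<close>, while the
  nearby \<open>z\<close> may reach the larger radius \<open>R\<close>, where \<open>V\<close> and
  \<open>P\<close> are controlled. \<open>M\<close> converts the velocity error of \<open>z\<close>
  into a loss of decay.\<close>

locale perturbed_lyapunov =
  fixes F :: "real \<Rightarrow> real \<Rightarrow> 'a::euclidean_space \<Rightarrow> 'a" and \<Omega> S :: "'a set" and qs :: 'a
    and fbar :: "'a \<Rightarrow> 'a" and V P :: "'a \<Rightarrow> real" and DV :: "'a \<Rightarrow> 'a \<Rightarrow> real" and r R M :: real
  assumes radii: "0 < r" "r < R" and closed_S: "closed S" and qs_S: "qs \<in> S"
    and global: "\<And>\<omega> t0 I q. \<omega> > 0 \<Longrightarrow> maximal_solution (F \<omega>) \<Omega> t0 I q \<Longrightarrow>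
        (\<And>t. t \<in> I \<Longrightarrow> q t \<in> cball qs r) \<Longrightarrow> I = {t0..}"
    and approx: "\<And>\<nu>. \<nu> > 0 \<Longrightarrow> \<exists>\<omega>0>0. \<forall>\<omega>>\<omega>0. tracks_averaged (F \<omega>) \<Omega> S (cball qs r) fbar \<nu>"
    and V_deriv: "\<And>z. z \<in> cball qs R \<Longrightarrow> (V has_derivative DV z) (at z)"
    and DV_bound: "\<And>z h. z \<in> cball qs R \<Longrightarrow> \<bar>DV z h\<bar> \<le> M * norm h"
    and P_cont: "continuous_on (cball qs R) P"
    and V_qs: "V qs = 0"
    and pos: "\<And>z. z \<in> cball qs R \<Longrightarrow> z \<in> S \<Longrightarrow> z \<noteq> qs \<Longrightarrow> V z > 0 \<and> P z > 0"
    and decay: "\<And>z. z \<in> cball qs R \<Longrightarrow> z \<in> S \<Longrightarrow> DV z (fbar z) \<le> - P z"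
begin

lemma V_cont: "continuous_on (cball qs R) V"
  using V_deriv has_derivative_continuous continuous_at_imp_continuous_on by blast

lemma compact_BS: "compact (cball qs R \<inter> S)"
  using closed_S by (intro compact_Int_closed compact_cball)

lemma M_nonneg: "M \<ge> 0"
proof -
  have "qs \<in> cball qs R" using radii by simp
  moreover obtain b :: 'a where "b \<in> Basis" by fastforce
  ultimately show ?thesis using DV_bound[of qs b] by (simp add: norm_Basis) 
qed

lemma V_nonneg: "z \<in> cball qs R \<inter> S \<Longrightarrow> V z \<ge> 0"
  using pos[of z] V_qs by (cases "z = qs") auto

text \<open>\<open>v0\<close> is the value of \<open>V\<close> at the start of the approximating
  curve. The last implication serves both goals: for stability \<open>v0 \<le> m\<close> holds from
  the start, for attractivity \<open>p * (T - t0)\<close> reaches the largest possible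
  \<open>v0\<close>.\<close>

lemma tracking:
  assumes "0 < e" "e \<le> r"
  obtains \<delta> m p \<omega>0 where "\<delta> > 0" "m > 0" "p > 0" "\<omega>0 > 0"
    "\<And>\<omega> t0 T q. \<omega> > \<omega>0 \<Longrightarrow> t0 \<le> T \<Longrightarrow> q t0 \<in> S \<Longrightarrow> solution_on (F \<omega>) \<Omega> {t0..T} q \<Longrightarrow>
       (\<And>t. t \<in> {t0..T} \<Longrightarrow> q t \<in> cball qs r) \<Longrightarrow>
       \<exists>v0. 0 \<le> v0 \<and> v0 \<le> Sup (V ` (cball qs R \<inter> S)) \<and> (norm (q t0 - qs) < \<delta> \<longrightarrow> v0 \<le> m) \<and>
         (v0 - p * (T - t0) \<le> m \<longrightarrow> norm (q T - qs) < e)"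
proof -
  let ?B = "cball qs R \<inter> S"
  have "compact (?B \<inter> {z. dist qs z \<ge> e / 2})"
    by (intro compact_Int_closed compact_BS closed_Collect_le continuous_intros)
  moreover have "continuous_on (?B \<inter> {z. dist qs z \<ge> e / 2}) V" by (rule continuous_on_subset[OF V_cont]) auto
  moreover have "V z > 0" if "z \<in> ?B \<inter> {z. dist qs z \<ge> e / 2}" for z
    using that pos[of z] \<open>0 < e\<close> by (cases "z = qs") auto
  ultimately obtain m' where m': "m' > 0" "\<And>z. z \<in> ?B \<Longrightarrow> dist qs z \<ge> e / 2 \<Longrightarrow> m' \<le> V z"
    using positive_lower_bound_on_compact by (metis (no_types, lifting) IntI mem_Collect_eq)
  \<comment> \<open>Halving gives a strict separation: \<open>V z \<le> m\<close> forces a distance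
    less than \<open>e / 2\<close>.\<close>
  define m where "m = m' / 2"
  have m: "m > 0" "\<And>z. z \<in> ?B \<Longrightarrow> V z \<le> m \<Longrightarrow> dist qs z < e / 2"
    using m' by (auto simp: m_def) (smt (verit, best) IntI field_sum_of_halves mem_cball m'(2))
  have "?B \<inter> V -` {m..} = ?B \<inter> (cball qs R \<inter> V -` {m..})" by auto
  moreover have "closed (cball qs R \<inter> V -` {m..})" by (intro continuous_closed_preimage V_cont) auto
  ultimately have "compact (?B \<inter> V -` {m..})" using compact_BS by (metis compact_Int_closed)
  moreover have "continuous_on (?B \<inter> V -` {m..}) P" by (rule continuous_on_subset[OF P_cont]) auto
  moreover have "P z > 0" if "z \<in> ?B \<inter> V -` {m..}" for z
    using that pos[of z] m V_qs by (cases "z = qs") auto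
  ultimately obtain p' where p': "p' > 0" "\<And>z. z \<in> ?B \<Longrightarrow> V z \<ge> m \<Longrightarrow> p' \<le> P z"
    using positive_lower_bound_on_compact[of "?B \<inter> V -` {m..}" P] by (metis IntI atLeast_iff vimageI)
  \<comment> \<open>The other half of the decay pays for the velocity error,
    \<open>M * \<nu> \<le> p\<close>.\<close>
  define p where "p = p' / 2"
  have p: "p > 0" using p' by (simp add: p_def)
  obtain d where d: "d > 0" "\<And>z. z \<in> cball qs R \<Longrightarrow> dist z qs < d \<Longrightarrow> V z < m"
  proof -
    have "qs \<in> cball qs R" using radii by simp
    then obtain d where "d > 0" "\<And>z. z \<in> cball qs R \<Longrightarrow> dist z qs < d \<Longrightarrow> dist (V z) (V qs) < m"
      using V_cont[unfolded continuous_on_iff] m(1) by metis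
    then show thesis using that[of d] V_qs by (fastforce simp: dist_real_def)
  qed
  \<comment> \<open>The four entries: \<open>z\<close> starts in the \<open>d\<close>-ball if
    \<open>q\<close> starts in the \<open>d / 2\<close>-ball; \<open>q T\<close> is within
    \<open>e\<close> if \<open>z T\<close> is within \<open>e / 2\<close>; \<open>z\<close> stays in
    the ball of radius \<open>R\<close>; the error costs at most \<open>p\<close>.
    \<open>M + 1\<close> covers \<open>M = 0\<close>.\<close>
  define \<nu> where "\<nu> = min (min (d / 2) (e / 2)) (min (R - r) (p / (M + 1)))"
  have \<nu>: "\<nu> > 0" "\<nu> \<le> d / 2" "\<nu> \<le> e / 2" "\<nu> \<le> R - r" "M * \<nu> \<le> p"
  proof -
    have "p / (M + 1) > 0" using p M_nonneg by simp
    then show "\<nu> > 0" "\<nu> \<le> d / 2" "\<nu> \<le> e / 2" "\<nu> \<le> R - r"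
      using d(1) assms radii unfolding \<nu>_def by linarith+
    have "\<nu> \<le> p / (M + 1)" by (simp add: \<nu>_def)
    then have "\<nu> * (M + 1) \<le> p" using M_nonneg by (simp add: pos_le_divide_eq)
    then show "M * \<nu> \<le> p" using \<open>\<nu> > 0\<close> by (simp add: algebra_simps)
  qed
  obtain \<omega>0 where \<omega>0: "\<omega>0 > 0" "\<And>\<omega>. \<omega> > \<omega>0 \<Longrightarrow> tracks_averaged (F \<omega>) \<Omega> S (cball qs r) fbar \<nu>"
    using approx[OF \<nu>(1)] by blast
  show thesis
  proof
    show "d / 2 > 0" "m > 0" "p > 0" "\<omega>0 > 0" using d m p \<omega>0 by auto
    fix \<omega> t0 T q assume hyp: "\<omega> > \<omega>0" "t0 \<le> T" "q t0 \<in> S" "solution_on (F \<omega>) \<Omega> {t0..T} q"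
      "\<And>t. t \<in> {t0..T} \<Longrightarrow> q t \<in> cball qs r"
    obtain z z' where z: "\<And>t. t \<in> {t0..T} \<Longrightarrow> z t \<in> S" "\<And>t. t \<in> {t0..T} \<Longrightarrow> norm (z t - q t) \<le> \<nu>"
      "\<And>t. t \<in> {t0..T} \<Longrightarrow> (z has_vector_derivative z' t) (at t within {t0..T})"
      "\<And>t. t \<in> {t0..T} \<Longrightarrow> norm (z' t - fbar (z t)) \<le> \<nu>"
    proof -
      have "t0 \<le> T \<and> q t0 \<in> S \<and> solution_on (F \<omega>) \<Omega> {t0..T} q \<and> (\<forall>t\<in>{t0..T}. q t \<in> cball qs r)"
        using hyp by simp
      from \<omega>0(2)[OF hyp(1), unfolded tracks_averaged_def, rule_format, OF this] that show ?thesis by metis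
    qed
    have zB: "z t \<in> ?B" if "t \<in> {t0..T}" for t
    proof -
      have "dist qs (z t) \<le> dist qs (q t) + dist (z t) (q t)" by (metis dist_commute dist_triangle)
      also have "\<dots> \<le> r + (R - r)"
        using z(2)[OF that] hyp(5)[OF that] \<nu>(4) by (intro add_mono) (auto simp: dist_norm)
      finally show ?thesis using z(1)[OF that] by simp
    qed
    have der: "((\<lambda>t. V (z t)) has_real_derivative DV (z t) (z' t)) (at t within {t0..T})" if t: "t \<in> {t0..T}" for t
    proof -
      have "(V has_derivative DV (z t)) (at (z t) within z ` {t0..T})"
        using zB[OF t] by (intro has_derivative_at_withinI[OF V_deriv]) auto
      from vector_derivative_diff_chain_within[OF z(3)[OF t] this] show ?thesis
        by (simp add: has_real_derivative_iff_has_vector_derivative o_def)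
    qed
    have dec: "DV (z t) (z' t) \<le> - p" if t: "t \<in> {t0..T}" and Vm: "V (z t) \<ge> m" for t
    proof -
      have lin: "linear (DV (z t))"
        using V_deriv[of "z t"] zB[OF t] has_derivative_linear by blast
      have "DV (z t) (z' t) = DV (z t) (fbar (z t)) + DV (z t) (z' t - fbar (z t))"
        using linear_diff[OF lin] by simp
      also have "DV (z t) (fbar (z t)) \<le> - p'" using decay[of "z t"] p'(2)[OF zB[OF t] Vm] zB[OF t] by auto
      also have "DV (z t) (z' t - fbar (z t)) \<le> M * norm (z' t - fbar (z t))"
        using DV_bound[of "z t" "z' t - fbar (z t)"] zB[OF t] by auto
      also have "\<dots> \<le> M * \<nu>" using z(4)[OF t] M_nonneg by (intro mult_left_mono) auto
      also have "- p' + M * \<nu> \<le> - p" using \<nu>(5) by (simp add: p_def)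
      finally show ?thesis by simp
    qed
    have bound: "V (z T) \<le> max m (V (z t0) - p * (T - t0))"
      using upper_comparison[OF der dec] p hyp(2) by auto
    show "\<exists>v0. 0 \<le> v0 \<and> v0 \<le> Sup (V ` ?B) \<and> (norm (q t0 - qs) < d / 2 \<longrightarrow> v0 \<le> m) \<and>
         (v0 - p * (T - t0) \<le> m \<longrightarrow> norm (q T - qs) < e)"
    proof (intro exI[of _ "V (z t0)"] conjI impI)
      have t0: "t0 \<in> {t0..T}" "T \<in> {t0..T}" using hyp by auto
      show "0 \<le> V (z t0)" by (rule V_nonneg[OF zB[OF t0(1)]])
      have "compact (V ` ?B)" by (intro compact_continuous_image compact_BS continuous_on_subset[OF V_cont]) auto
      then show "V (z t0) \<le> Sup (V ` ?B)"
        using zB[OF t0(1)] by (intro cSup_upper imageI bounded_imp_bdd_above compact_imp_bounded)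
      show "V (z t0) \<le> m" if "norm (q t0 - qs) < d / 2"
      proof -
        have "dist (z t0) qs < d" using that z(2)[OF t0(1)] \<nu>(2) norm_triangle_ineq[of "z t0 - q t0" "q t0 - qs"]
          by (simp add: dist_norm)
        then show ?thesis using d zB[OF t0(1)] by force
      qed
      show "norm (q T - qs) < e" if "V (z t0) - p * (T - t0) \<le> m"
      proof -
        have "dist qs (z T) < e / 2" using bound that m(2)[OF zB[OF t0(2)]] by auto
        then show ?thesis using z(2)[OF t0(2)] \<nu>(3) norm_triangle_ineq[of "q T - z T" "z T - qs"]
          by (simp add: dist_norm norm_minus_commute)
      qed
    qed
  qed
qed

section \<open>From tracking to stability and attractivity\<close>

definition confined :: "real \<Rightarrow> real \<Rightarrow> real \<Rightarrow> bool" where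
  "confined e \<delta> \<omega>0 \<longleftrightarrow> (\<forall>\<omega>>\<omega>0. \<forall>t0 I q.
     maximal_solution (F \<omega>) \<Omega> t0 I q \<and> q t0 \<in> S \<and> norm (q t0 - qs) < \<delta> \<longrightarrow>
     I = {t0..} \<and> (\<forall>t\<ge>t0. norm (q t - qs) < e))"

lemma confinedD:
  assumes "confined e \<delta> \<omega>0" "\<omega> > \<omega>0" "maximal_solution (F \<omega>) \<Omega> t0 I q" "q t0 \<in> S" "norm (q t0 - qs) < \<delta>"
  shows "I = {t0..}" "\<And>t. t \<ge> t0 \<Longrightarrow> norm (q t - qs) < e"
  using assms unfolding confined_def by auto

text \<open>First-exit argument: up to the first time \<open>T\<close> with distance at least
  \<open>e\<close> the solution is in the ball of radius \<open>r\<close>, so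
  \<open>tracking\<close> applies on \<open>{t0..T}\<close> and makes the distance at
  \<open>T\<close> less than \<open>e\<close>, a contradiction.\<close>

lemma ex_confined:
  assumes e: "0 < e" "e \<le> r"
  shows "\<exists>\<delta>>0. \<exists>\<omega>0>0. confined e \<delta> \<omega>0"
proof -
  obtain \<delta> m p \<omega>0 where \<delta>: "\<delta> > 0" "m > 0" "p > 0" "\<omega>0 > 0"
    and key: "\<And>\<omega> t0 T q. \<omega> > \<omega>0 \<Longrightarrow> t0 \<le> T \<Longrightarrow> q t0 \<in> S \<Longrightarrow> solution_on (F \<omega>) \<Omega> {t0..T} q \<Longrightarrow>
       (\<And>t. t \<in> {t0..T} \<Longrightarrow> q t \<in> cball qs r) \<Longrightarrow>
       \<exists>v0. 0 \<le> v0 \<and> v0 \<le> Sup (V ` (cball qs R \<inter> S)) \<and> (norm (q t0 - qs) < \<delta> \<longrightarrow> v0 \<le> m) \<and>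
         (v0 - p * (T - t0) \<le> m \<longrightarrow> norm (q T - qs) < e)"
    using tracking[OF e] by blast
  \<comment> \<open>\<open>\<delta>\<close> yields \<open>v0 \<le> m\<close>; the bound
    \<open>e\<close> settles an exit at \<open>T = t0\<close>.\<close>
  have "confined e (min \<delta> e) \<omega>0"
    unfolding confined_def
  proof (intro allI impI, elim conjE)
    fix \<omega> t0 I q assume hyp: "\<omega> > \<omega>0" "maximal_solution (F \<omega>) \<Omega> t0 I q" "q t0 \<in> S" "norm (q t0 - qs) < min \<delta> e"
    have I: "is_interval I" "t0 \<in> I" "I \<subseteq> {t0..}" and sol: "solution_on (F \<omega>) \<Omega> I q"
      using hyp(2) by (auto simp: maximal_solution_def)
    have "continuous_on I q" using sol
      unfolding solution_on_def continuous_on_eq_continuous_within by (meson has_vector_derivative_continuous)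
    have small: "norm (q t - qs) < e" if t: "t \<in> I" for t
    proof (rule ccontr)
      assume neg: "\<not> norm (q t - qs) < e"
      have sub: "{t0..t} \<subseteq> I" using mem_is_interval_1_I[OF I(1,2) t] by (meson atLeastAtMost_iff subsetI)
      have cont: "continuous_on {t0..t} (\<lambda>s. norm (q s - qs))"
        by (intro continuous_intros continuous_on_subset[OF \<open>continuous_on I q\<close> sub])
      define A where "A = {t0..t} \<inter> (\<lambda>s. norm (q s - qs)) -` {e..}"
      have "closed A" unfolding A_def by (intro continuous_closed_preimage cont) auto
      moreover have "t \<in> A" using neg t I by (auto simp: A_def)
      then have "A \<noteq> {}" by blast
      moreover have "bdd_below A" by (auto simp: A_def)
      ultimately have T: "Inf A \<in> A" by (metis closed_contains_Inf)
      define T where "T = Inf A"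
      have T': "t0 \<le> T" "T \<le> t" "norm (q T - qs) \<ge> e" using T by (auto simp: A_def T_def)
      have before: "norm (q s - qs) < e" if "s \<in> {t0..<T}" for s
      proof (rule ccontr)
        assume "\<not> ?thesis"
        then have "s \<in> A" using that T' by (auto simp: A_def)
        then show False using cInf_lower[OF _ \<open>bdd_below A\<close>] that unfolding T_def by fastforce
      qed
      \<comment> \<open>At \<open>T\<close> itself the bound follows by continuity and is not
        strict; the closed ball in \<open>tracking\<close> admits this.\<close>
      have le: "norm (q s - qs) \<le> e" if s: "s \<in> {t0..T}" for s
      proof (cases "t0 = T")
        case True
        then show ?thesis using hyp(4) s by auto
      next
        case False
        then have cl: "closure {t0..<T} = {t0..T}" using T' by simp
        have "norm (q s - qs) \<le> e"
          by (rule continuous_le_on_closure[of "{t0..<T}" "\<lambda>s. norm (q s - qs)"])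
            (use cl s before T' in \<open>auto intro: continuous_on_subset[OF cont] less_imp_le\<close>)
        then show ?thesis .
      qed
      have "\<exists>v0. 0 \<le> v0 \<and> v0 \<le> Sup (V ` (cball qs R \<inter> S)) \<and> (norm (q t0 - qs) < \<delta> \<longrightarrow> v0 \<le> m) \<and>
         (v0 - p * (T - t0) \<le> m \<longrightarrow> norm (q T - qs) < e)"
        by (rule key[OF hyp(1) T'(1) hyp(3) solution_on_subset[OF sol]])
          (use sub T' le e in \<open>auto simp: dist_norm norm_minus_commute intro: order_trans\<close>)
      moreover have "p * (T - t0) \<ge> 0" using \<delta> T' by simp
      ultimately show False using hyp(4) T'(3) by auto
    qed
    have "I = {t0..}"
      by (rule global[OF _ hyp(2)]) (use hyp \<delta> small e in \<open>fastforce simp: dist_norm norm_minus_commute\<close>)+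
    then show "I = {t0..} \<and> (\<forall>t\<ge>t0. norm (q t - qs) < e)" using small by auto
  qed
  then show ?thesis using \<delta> e by (meson min_less_iff_conj)
qed

lemma practical_asymptotic_stability: "practically_uniformly_asymptotically_stable F \<Omega> S qs"
  unfolding practically_uniformly_asymptotically_stable_def
proof
  show "practically_uniformly_stable F \<Omega> S qs"
    unfolding practically_uniformly_stable_def
  proof (intro allI impI)
    fix e :: real assume "e > 0"
    \<comment> \<open>\<open>tracking\<close> works up to radius \<open>r\<close>, so a larger
      \<open>e\<close> is cut down.\<close>
    then have er: "0 < min e r" "min e r \<le> r" using radii by auto
    obtain \<delta> \<omega>0 where *: "\<delta> > 0" and **: "\<omega>0 > 0" and st: "confined (min e r) \<delta> \<omega>0"
      using ex_confined[OF er] by auto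
    show "\<exists>\<delta>>0. \<exists>\<omega>0>0. \<forall>\<omega>>\<omega>0. \<forall>t0\<ge>0. \<forall>I q.
        maximal_solution (F \<omega>) \<Omega> t0 I q \<and> q t0 \<in> S \<and> norm (q t0 - qs) < \<delta> \<longrightarrow>
        I = {t0..} \<and> (\<forall>t\<ge>t0. norm (q t - qs) < e)"
    proof (rule exI[of _ \<delta>], rule conjI[OF *], rule exI[of _ \<omega>0], rule conjI[OF **], intro allI impI, elim conjE)
      fix \<omega> t0 I q assume "\<omega> > \<omega>0" "maximal_solution (F \<omega>) \<Omega> t0 I q" "q t0 \<in> S" "norm (q t0 - qs) < \<delta>"
      from confinedD[OF st this] show "I = {t0..} \<and> (\<forall>t\<ge>t0. norm (q t - qs) < e)" by auto
    qed
  qed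
  show "practically_uniformly_attractive F \<Omega> S qs"
    unfolding practically_uniformly_attractive_def
  proof -
    \<comment> \<open>This \<open>\<delta>\<close> is fixed before \<open>e\<close>: it confines
      solutions to the ball of radius \<open>r\<close>, where \<open>tracking\<close> applies for
      every smaller target.\<close>
    obtain \<delta> \<omega>1 where st: "\<delta> > 0" "\<omega>1 > 0" "confined r \<delta> \<omega>1"
      using ex_confined[OF radii(1) order_refl] by auto
    have "\<exists>tf\<ge>0. \<exists>\<omega>0>0. \<forall>\<omega>>\<omega>0. \<forall>t0\<ge>0. \<forall>I q.
        maximal_solution (F \<omega>) \<Omega> t0 I q \<and> q t0 \<in> S \<and> norm (q t0 - qs) < \<delta> \<longrightarrow>
        I = {t0..} \<and> (\<forall>t\<ge>t0 + tf. norm (q t - qs) < e)" if "e > 0" for e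
    proof -
      have er: "0 < min e r" "min e r \<le> r" using radii \<open>e > 0\<close> by auto
      obtain \<delta>' m p \<omega>2 where "\<delta>' > 0" and tr: "m > 0" "p > 0" "\<omega>2 > 0"
        "\<And>\<omega> t0 T q. \<omega> > \<omega>2 \<Longrightarrow> t0 \<le> T \<Longrightarrow> q t0 \<in> S \<Longrightarrow> solution_on (F \<omega>) \<Omega> {t0..T} q \<Longrightarrow>
       (\<And>t. t \<in> {t0..T} \<Longrightarrow> q t \<in> cball qs r) \<Longrightarrow>
       \<exists>v0. 0 \<le> v0 \<and> v0 \<le> Sup (V ` (cball qs R \<inter> S)) \<and> (norm (q t0 - qs) < \<delta>' \<longrightarrow> v0 \<le> m) \<and>
         (v0 - p * (T - t0) \<le> m \<longrightarrow> norm (q T - qs) < min e r)"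
        using tracking[OF er] by blast
      \<comment> \<open>The time in which a decrease at rate \<open>p\<close> uses up the largest
        value of \<open>V\<close> on the admissible part of the ball.\<close>
      define tf where "tf = max 0 (Sup (V ` (cball qs R \<inter> S)) / p)"
      have "I = {t0..} \<and> (\<forall>t\<ge>t0 + tf. norm (q t - qs) < e)"
        if hyp: "\<omega> > max \<omega>1 \<omega>2" "maximal_solution (F \<omega>) \<Omega> t0 I q" "q t0 \<in> S" "norm (q t0 - qs) < \<delta>" for \<omega> t0 I q
      proof -
        have I: "I = {t0..}" "\<And>t. t \<ge> t0 \<Longrightarrow> norm (q t - qs) < r"
          using confinedD[OF st(3) _ hyp(2-4)] hyp(1) by auto
        have sol: "solution_on (F \<omega>) \<Omega> {t0..} q" using hyp(2) I by (auto simp: maximal_solution_def)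
        have "norm (q T - qs) < e" if T: "T \<ge> t0 + tf" for T
        proof -
          have T0: "t0 \<le> T" using T by (auto simp: tf_def)
          have "\<exists>v0. 0 \<le> v0 \<and> v0 \<le> Sup (V ` (cball qs R \<inter> S)) \<and> (norm (q t0 - qs) < \<delta>' \<longrightarrow> v0 \<le> m) \<and>
             (v0 - p * (T - t0) \<le> m \<longrightarrow> norm (q T - qs) < min e r)"
            by (rule tr(4)[OF _ T0 hyp(3) solution_on_subset[OF sol]])
              (use hyp(1) I in \<open>auto simp: dist_norm norm_minus_commute less_imp_le\<close>)
          moreover have "Sup (V ` (cball qs R \<inter> S)) \<le> p * (T - t0)"
          proof -
            have "Sup (V ` (cball qs R \<inter> S)) / p \<le> T - t0" using T by (auto simp: tf_def)
            then show ?thesis using tr(2) by (simp add: pos_divide_le_eq mult.commute)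
          qed
          ultimately show ?thesis using tr(1) by auto
        qed
        then show ?thesis using I by blast
      qed
      moreover have "tf \<ge> 0" "max \<omega>1 \<omega>2 > 0" using st by (auto simp: tf_def)
      ultimately show ?thesis by blast
    qed
    then show "\<exists>\<delta>>0. \<forall>e>0. \<exists>tf\<ge>0. \<exists>\<omega>0>0. \<forall>\<omega>>\<omega>0. \<forall>t0\<ge>0. \<forall>I q.
        maximal_solution (F \<omega>) \<Omega> t0 I q \<and> q t0 \<in> S \<and> norm (q t0 - qs) < \<delta> \<longrightarrow>
        I = {t0..} \<and> (\<forall>t\<ge>t0 + tf. norm (q t - qs) < e)" using st(1) by blast
  qed
qed

end

section \<open>Continuously differentiable functions\<close>

definition C1_on :: "'a::real_normed_vector set \<Rightarrow> ('a \<Rightarrow> 'b::real_normed_vector) \<Rightarrow> bool" where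
  "C1_on S f \<longleftrightarrow> (\<exists>f'. (\<forall>x\<in>S. (f has_derivative blinfun_apply (f' x)) (at x)) \<and> continuous_on S f')"

text \<open>On a Euclidean domain, continuity in the operator norm follows from continuity in each
  direction \<open>h\<close>, so derivative formulas can be given pointwise in
  \<open>h\<close>.\<close>

lemma C1_onI:
  fixes f :: "'a::euclidean_space \<Rightarrow> 'b::real_normed_vector"
  assumes der: "\<And>x. x \<in> S \<Longrightarrow> (f has_derivative f' x) (at x)"
    and cont: "\<And>h. continuous_on S (\<lambda>x. f' x h)"
  shows "C1_on S f"
  unfolding C1_on_def
proof (intro exI conjI ballI)
  have bl: "bounded_linear (f' x)" if "x \<in> S" for x using der[OF that] by (rule has_derivative_bounded_linear)
  show "(f has_derivative blinfun_apply (Blinfun (f' x))) (at x)" if "x \<in> S" for x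
    using der[OF that] bl[OF that] by (simp add: bounded_linear_Blinfun_apply)
  have "continuous_on S (\<lambda>x. blinfun_apply (Blinfun (f' x)) h)" for h
    using cont[of h] by (rule continuous_on_cong[THEN iffD1, rotated -1]) (use bl in \<open>simp_all add: bounded_linear_Blinfun_apply\<close>)
  then show "continuous_on S (\<lambda>x. Blinfun (f' x))" by (intro continuous_on_blinfun_componentwise)
qed

lemma C1_onE:
  assumes "C1_on S f"
  obtains f' where "\<And>x. x \<in> S \<Longrightarrow> (f has_derivative blinfun_apply (f' x)) (at x)" "continuous_on S f'"
  using assms unfolding C1_on_def by blast

lemma C1_on_continuous: "C1_on S f \<Longrightarrow> continuous_on S f"
  unfolding C1_on_def by (meson continuous_at_imp_continuous_on has_derivative_continuous)

lemma C1_on_const: "C1_on S (\<lambda>x::'a::euclidean_space. c)"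
  by (rule C1_onI[where f' = "\<lambda>_ _. 0"]) auto

lemma C1_on_bounded_linear:
  fixes f :: "'a::euclidean_space \<Rightarrow> 'b::real_normed_vector"
  assumes "bounded_linear L" "C1_on S f"
  shows "C1_on S (\<lambda>x. L (f x))"
proof -
  interpret bounded_linear L by fact
  obtain f' where f': "\<And>x. x \<in> S \<Longrightarrow> (f has_derivative blinfun_apply (f' x)) (at x)" "continuous_on S f'"
    using C1_onE[OF assms(2)] by blast
  show ?thesis
    by (rule C1_onI[where f' = "\<lambda>x h. L (f' x h)"])
      (auto intro!: has_derivative continuous_on f' continuous_intros)
qed

lemma C1_on_bilinear:
  fixes f :: "'a::euclidean_space \<Rightarrow> 'b::real_normed_vector"
  assumes "bounded_bilinear B" "C1_on S f" "C1_on S g"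
  shows "C1_on S (\<lambda>x. B (f x) (g x))"
proof -
  interpret bounded_bilinear B by fact
  obtain f' where f': "\<And>x. x \<in> S \<Longrightarrow> (f has_derivative blinfun_apply (f' x)) (at x)" "continuous_on S f'"
    using C1_onE[OF assms(2)] by blast
  obtain g' where g': "\<And>x. x \<in> S \<Longrightarrow> (g has_derivative blinfun_apply (g' x)) (at x)" "continuous_on S g'"
    using C1_onE[OF assms(3)] by blast
  show ?thesis
    by (rule C1_onI[where f' = "\<lambda>x h. B (f x) (g' x h) + B (f' x h) (g x)"])
      (auto intro!: FDERIV continuous_on f' g' continuous_intros C1_on_continuous[OF assms(2)]
        C1_on_continuous[OF assms(3)])
qed

lemma C1_on_add:
  fixes f :: "'a::euclidean_space \<Rightarrow> 'b::real_normed_vector"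
  assumes "C1_on S f" "C1_on S g"
  shows "C1_on S (\<lambda>x. f x + g x)"
proof -
  obtain f' where f': "\<And>x. x \<in> S \<Longrightarrow> (f has_derivative blinfun_apply (f' x)) (at x)" "continuous_on S f'"
    using C1_onE[OF assms(1)] by blast
  obtain g' where g': "\<And>x. x \<in> S \<Longrightarrow> (g has_derivative blinfun_apply (g' x)) (at x)" "continuous_on S g'"
    using C1_onE[OF assms(2)] by blast
  show ?thesis
    by (rule C1_onI[where f' = "\<lambda>x h. g' x h + f' x h"])
      (auto intro!: derivative_eq_intros f' g' continuous_intros simp: add.commute)
qed

lemma C1_on_compose:
  fixes f :: "'a::euclidean_space \<Rightarrow> 'b::real_normed_vector"
  assumes "C1_on S f" "C1_on T g" "f ` S \<subseteq> T"
  shows "C1_on S (\<lambda>x. g (f x))"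
proof -
  obtain f' where f': "\<And>x. x \<in> S \<Longrightarrow> (f has_derivative blinfun_apply (f' x)) (at x)" "continuous_on S f'"
    using C1_onE[OF assms(1)] by blast
  obtain g' where g': "\<And>x. x \<in> T \<Longrightarrow> (g has_derivative blinfun_apply (g' x)) (at x)" "continuous_on T g'"
    using C1_onE[OF assms(2)] by blast
  show ?thesis
  proof (rule C1_onI[where f' = "\<lambda>x h. g' (f x) (f' x h)"])
    show "((\<lambda>x. g (f x)) has_derivative (\<lambda>h. g' (f x) (f' x h))) (at x)" if "x \<in> S" for x
      using diff_chain_at[OF f'(1)[OF that] g'(1)] assms(3) that by (auto simp: o_def)
    have "continuous_on S (\<lambda>x. g' (f x))"
      by (rule continuous_on_compose2[OF g'(2) C1_on_continuous[OF assms(1)] assms(3)])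
    then show "continuous_on S (\<lambda>x. g' (f x) (f' x h))" for h
      by (intro continuous_intros f')
  qed
qed

text \<open>Reduces the closure rules for C2 to those for C1, applied to the operator-valued
  derivative.\<close>

lemma C2_on_iff: "C2_on S f \<longleftrightarrow> (\<exists>f'. (\<forall>x\<in>S. (f has_derivative blinfun_apply (f' x)) (at x)) \<and> C1_on S f')"
  unfolding C2_on_def C1_on_def by blast

lemma C2_onI:
  assumes "\<And>x. x \<in> S \<Longrightarrow> (f has_derivative blinfun_apply (f' x)) (at x)" "C1_on S f'"
  shows "C2_on S f"
  using assms unfolding C2_on_iff by blast

lemma C2_onE:
  assumes "C2_on S f"
  obtains f' where "\<And>x. x \<in> S \<Longrightarrow> (f has_derivative blinfun_apply (f' x)) (at x)" "C1_on S f'"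
  using assms unfolding C2_on_iff by blast

lemma C2_on_imp_C1_on: "C2_on S f \<Longrightarrow> C1_on S f"
  unfolding C2_on_iff C1_on_def[of S f] using C1_on_continuous by blast

lemma C2_on_linear:
  fixes L :: "'a::euclidean_space \<Rightarrow> 'b::real_normed_vector"
  assumes "bounded_linear L" shows "C2_on S L"
  by (rule C2_onI[where f' = "\<lambda>_. Blinfun L"])
    (use assms in \<open>auto simp: bounded_linear_Blinfun_apply C1_on_const intro: bounded_linear_imp_has_derivative\<close>)

lemma C2_on_const: "C2_on S (\<lambda>x::'a::euclidean_space. c)"
  by (rule C2_onI[where f' = "\<lambda>_. 0"]) (auto simp: C1_on_const zero_blinfun.rep_eq)

lemma C2_on_add:
  fixes f :: "'a::euclidean_space \<Rightarrow> 'b::real_normed_vector"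
  assumes "C2_on S f" "C2_on S g"
  shows "C2_on S (\<lambda>x. f x + g x)"
proof -
  obtain f' where f': "\<And>x. x \<in> S \<Longrightarrow> (f has_derivative blinfun_apply (f' x)) (at x)" "C1_on S f'"
    using C2_onE[OF assms(1)] by blast
  obtain g' where g': "\<And>x. x \<in> S \<Longrightarrow> (g has_derivative blinfun_apply (g' x)) (at x)" "C1_on S g'"
    using C2_onE[OF assms(2)] by blast
  show ?thesis
    by (rule C2_onI[where f' = "\<lambda>x. f' x + g' x"])
      (auto intro!: derivative_eq_intros f' g' C1_on_add simp: blinfun.bilinear_simps)
qed

lemma C2_on_bounded_linear:
  fixes f :: "'a::euclidean_space \<Rightarrow> 'b::real_normed_vector"
  assumes "bounded_linear L" "C2_on S f"
  shows "C2_on S (\<lambda>x. L (f x))"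
proof -
  obtain f' where f': "\<And>x. x \<in> S \<Longrightarrow> (f has_derivative blinfun_apply (f' x)) (at x)" "C1_on S f'"
    using C2_onE[OF assms(2)] by blast
  have "((\<lambda>x. L (f x)) has_derivative blinfun_apply (Blinfun L o\<^sub>L f' x)) (at x)" if "x \<in> S" for x
    using bounded_linear.has_derivative[OF assms(1) f'(1)[OF that]] assms(1)
    by (simp add: bounded_linear_Blinfun_apply blinfun_compose.rep_eq o_def)
  moreover have "C1_on S (\<lambda>x. Blinfun L o\<^sub>L f' x)"
    by (intro C1_on_bilinear[OF bounded_bilinear_blinfun_compose] C1_on_const f')
  ultimately show ?thesis by (rule C2_onI)
qed

lemma C2_on_mult:
  fixes f g :: "'a::euclidean_space \<Rightarrow> real"
  assumes "C2_on S f" "C2_on S g"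
  shows "C2_on S (\<lambda>x. f x * g x)"
proof -
  obtain f' where f': "\<And>x. x \<in> S \<Longrightarrow> (f has_derivative blinfun_apply (f' x)) (at x)" "C1_on S f'"
    using C2_onE[OF assms(1)] by blast
  obtain g' where g': "\<And>x. x \<in> S \<Longrightarrow> (g has_derivative blinfun_apply (g' x)) (at x)" "C1_on S g'"
    using C2_onE[OF assms(2)] by blast
  have "((\<lambda>x. f x * g x) has_derivative blinfun_apply (f x *\<^sub>R g' x + g x *\<^sub>R f' x)) (at x)" if "x \<in> S" for x
    using has_derivative_mult[OF f'(1)[OF that] g'(1)[OF that]]
    by (simp add: blinfun.bilinear_simps mult.commute plus_blinfun.rep_eq)
  moreover have "C1_on S (\<lambda>x. f x *\<^sub>R g' x + g x *\<^sub>R f' x)"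
    by (intro C1_on_add C1_on_bilinear[OF bounded_bilinear_scaleR] f' g' C2_on_imp_C1_on assms)
  ultimately show ?thesis by (rule C2_onI)
qed

lemma C2_on_compose:
  fixes f :: "'a::euclidean_space \<Rightarrow> 'b::euclidean_space" and g :: "'b \<Rightarrow> 'c::real_normed_vector"
  assumes "C2_on S f" "C2_on T g" "f ` S \<subseteq> T"
  shows "C2_on S (\<lambda>x. g (f x))"
proof -
  obtain f' where f': "\<And>x. x \<in> S \<Longrightarrow> (f has_derivative blinfun_apply (f' x)) (at x)" "C1_on S f'"
    using C2_onE[OF assms(1)] by blast
  obtain g' where g': "\<And>x. x \<in> T \<Longrightarrow> (g has_derivative blinfun_apply (g' x)) (at x)" "C1_on T g'"
    using C2_onE[OF assms(2)] by blast
  have "((\<lambda>x. g (f x)) has_derivative blinfun_apply (g' (f x) o\<^sub>L f' x)) (at x)" if "x \<in> S" for x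
    using diff_chain_at[OF f'(1)[OF that] g'(1)] assms(3) that by (auto simp: o_def blinfun_compose.rep_eq)
  moreover have "C1_on S (\<lambda>x. g' (f x) o\<^sub>L f' x)"
    by (intro C1_on_bilinear[OF bounded_bilinear_blinfun_compose] f'
        C1_on_compose[OF C2_on_imp_C1_on[OF assms(1)] g'(2) assms(3)])
  ultimately show ?thesis by (rule C2_onI)
qed

text \<open>The derivative as an operator is multiplication by the number \<open>f' x\<close>; the
  passage from number to operator is bounded linear and so preserves C1.\<close>

lemma C2_on_real:
  fixes f f' f'' :: "real \<Rightarrow> real"
  assumes "\<And>x. x \<in> S \<Longrightarrow> (f has_real_derivative f' x) (at x)"
    and "\<And>x. x \<in> S \<Longrightarrow> (f' has_real_derivative f'' x) (at x)" and "continuous_on S f''"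
  shows "C2_on S f"
proof (rule C2_onI)
  have "C1_on S f'"
    by (rule C1_onI[where f' = "\<lambda>x h. f'' x * h"])
      (use assms in \<open>auto simp: has_field_derivative_def intro!: continuous_intros\<close>)
  then show "C1_on S (\<lambda>x. blinfun_scaleR_left (f' x))"
    by (rule C1_on_bounded_linear[OF bounded_linear_blinfun_scaleR_left])
  show "(f has_derivative blinfun_apply (blinfun_scaleR_left (f' x))) (at x)" if "x \<in> S" for x
    using assms(1)[OF that] by (simp add: has_field_derivative_def mult_commute_abs)
qed

lemma C2_on_inverse_sqrt: "C2_on {0<..} (\<lambda>s. 1 / sqrt s)"
proof -
  have eq: "(\<lambda>s. 1 / sqrt s) x = x powr (- 1 / 2)" if "x > 0" for x
    using that by (simp add: powr_half_sqrt[symmetric] powr_minus_divide)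
  show ?thesis
  proof (rule C2_on_real[where f' = "\<lambda>s. - 1 / 2 * s powr (- 3 / 2)" and f'' = "\<lambda>s. 3 / 4 * s powr (- 5 / 2)"])
    fix x :: real assume "x \<in> {0<..}"
    then have x: "x > 0" by simp
    have "((\<lambda>s. s powr (- 1 / 2)) has_real_derivative (- 1 / 2 * x powr (- 3 / 2))) (at x)"
      using x by (auto intro!: derivative_eq_intros)
    then show "((\<lambda>s. 1 / sqrt s) has_real_derivative - 1 / 2 * x powr (- 3 / 2)) (at x)"
      by (rule has_field_derivative_transform_within_open[of _ _ _ "{0<..}"]) (use x eq in auto)
    show "((\<lambda>s. - 1 / 2 * s powr (- 3 / 2)) has_real_derivative 3 / 4 * x powr (- 5 / 2)) (at x)"
      using x by (auto intro!: derivative_eq_intros)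
  qed (auto intro!: continuous_intros)
qed

section \<open>Lie bracket averaging\<close>

text \<open>Supplies what the continuation lemmas require, at each fixed frequency.\<close>

lemma C1_on_oscillating_field:
  fixes f :: "'a::euclidean_space \<Rightarrow> 'a" and g :: "'j::finite \<Rightarrow> 'a \<Rightarrow> 'a"
  assumes "open \<Omega>" "C1_on \<Omega> f" "\<And>j. C1_on \<Omega> (g j)"
  shows "continuous_on (UNIV \<times> \<Omega>) (\<lambda>(t, x). oscillating_field w \<theta> f g \<omega> t x)"
    and "local_lipschitz UNIV \<Omega> (oscillating_field w \<theta> f g \<omega>)"
proof -
  have snd: "continuous_on (UNIV \<times> \<Omega>) (\<lambda>p::real \<times> 'a. h (snd p))" if "continuous_on \<Omega> h" for h :: "'a \<Rightarrow> 'c::topological_space"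
    by (rule continuous_on_compose2[OF that]) (auto intro: continuous_intros)
  show "continuous_on (UNIV \<times> \<Omega>) (\<lambda>(t, x). oscillating_field w \<theta> f g \<omega> t x)"
    unfolding oscillating_field_def case_prod_beta
    by (intro continuous_intros snd C1_on_continuous assms)
  obtain f' where f': "\<And>x. x \<in> \<Omega> \<Longrightarrow> (f has_derivative blinfun_apply (f' x)) (at x)" "continuous_on \<Omega> f'"
    using C1_onE[OF assms(2)] by blast
  have "\<forall>j. \<exists>g'. (\<forall>x\<in>\<Omega>. (g j has_derivative blinfun_apply (g' x)) (at x)) \<and> continuous_on \<Omega> g'"
    using assms(3) unfolding C1_on_def by blast
  then obtain g' where g': "\<And>j x. x \<in> \<Omega> \<Longrightarrow> (g j has_derivative blinfun_apply (g' j x)) (at x)"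
    "\<And>j. continuous_on \<Omega> (g' j)" by metis
  show "local_lipschitz UNIV \<Omega> (oscillating_field w \<theta> f g \<omega>)"
  proof (rule c1_implies_local_lipschitz)
    let ?D = "\<lambda>p. f' (snd p) + sqrt \<omega> *\<^sub>R (\<Sum>j\<in>UNIV. cos (w j * (\<omega> * fst p) - \<theta> j) *\<^sub>R g' j (snd p))"
    show "continuous_on (UNIV \<times> \<Omega>) ?D" by (intro continuous_intros snd f' g')
    fix t x assume "x \<in> \<Omega>"
    have "(oscillating_field w \<theta> f g \<omega> t has_derivative
       (\<lambda>h. f' x h + sqrt \<omega> *\<^sub>R (\<Sum>j\<in>UNIV. cos (w j * (\<omega> * t) - \<theta> j) *\<^sub>R g' j x h))) (at x)"
      unfolding oscillating_field_def
      by (intro has_derivative_add has_derivative_scaleR_right has_derivative_sum f' g' \<open>x \<in> \<Omega>\<close>)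
    moreover have "blinfun_apply (?D (t, x)) =
       (\<lambda>h. f' x h + sqrt \<omega> *\<^sub>R (\<Sum>j\<in>UNIV. cos (w j * (\<omega> * t) - \<theta> j) *\<^sub>R g' j x h))"
      by (simp add: fun_eq_iff blinfun.bilinear_simps)
    ultimately show "(oscillating_field w \<theta> f g \<omega> t has_derivative blinfun_apply (?D (t, x))) (at x)"
      by simp
  qed (use assms in auto)
qed

text \<open>The estimates compare \<open>z'\<close> with the averaged field at \<open>q t\<close>;
  uniform continuity of that field on the ball moves the comparison to \<open>z t\<close>. The
  premise \<open>inv\<close> speaks of whole solutions because membership in \<open>S\<close> comes
  from the dynamics.\<close>

lemma oscillating_field_tracks_averaged:
  fixes f :: "'a::euclidean_space \<Rightarrow> 'a" and g :: "'j::finite \<Rightarrow> 'a \<Rightarrow> 'a"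
  assumes R: "r < R" "cball qs R \<subseteq> \<Omega>"
    and f: "C1_on \<Omega> f" and g: "\<And>j x. x \<in> \<Omega> \<Longrightarrow> (g j has_derivative blinfun_apply (g' j x)) (at x)"
    and g': "\<And>j. C1_on \<Omega> (g' j)" and w: "\<And>j. w j > 0"
    and inv: "\<And>\<omega> t0 T t q. q t0 \<in> S \<Longrightarrow> solution_on (oscillating_field w \<theta> f g \<omega>) \<Omega> {t0..T} q \<Longrightarrow>
        t \<in> {t0..T} \<Longrightarrow> near_identity w \<theta> g g' \<omega> t (q t) \<in> S"
    and \<nu>: "\<nu> > 0"
  shows "\<exists>\<omega>0>0. \<forall>\<omega>>\<omega>0. tracks_averaged (oscillating_field w \<theta> f g \<omega>) \<Omega> S (cball qs r)
           (averaged_field w \<theta> f g g') \<nu>"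
proof -
  let ?K = "cball qs R" and ?fb = "averaged_field w \<theta> f g g'"
  have gC1: "C1_on \<Omega> (g j)" for j using g C1_on_continuous[OF g'] unfolding C1_on_def by blast
  have "\<exists>c'. (\<forall>x\<in>\<Omega>. ((\<lambda>x. g' j x (g l x)) has_derivative blinfun_apply (c' x)) (at x)) \<and> continuous_on \<Omega> c'" for j l
    using C1_on_bilinear[OF bounded_bilinear_blinfun_apply g' gC1, of j l] unfolding C1_on_def .
  then obtain c' where c': "\<And>j l x. x \<in> \<Omega> \<Longrightarrow> ((\<lambda>x. g' j x (g l x)) has_derivative blinfun_apply (c' j l x)) (at x)"
    "\<And>j l. continuous_on \<Omega> (c' j l)" by metis
  have contK: "continuous_on ?K h" if "continuous_on \<Omega> h" for h :: "'a \<Rightarrow> 'c::topological_space"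
    using continuous_on_subset[OF that R(2)] .
  obtain C where C: "C \<ge> 0"
    "\<And>\<omega> t x. \<omega> \<ge> 1 \<Longrightarrow> x \<in> ?K \<Longrightarrow> norm (near_identity w \<theta> g g' \<omega> t x - x) \<le> C / sqrt \<omega>"
    "\<And>\<omega> I q t. \<omega> \<ge> 1 \<Longrightarrow> q t \<in> ?K \<Longrightarrow>
       (q has_vector_derivative oscillating_field w \<theta> f g \<omega> t (q t)) (at t within I) \<Longrightarrow>
       \<exists>d. ((\<lambda>s. near_identity w \<theta> g g' \<omega> s (q s)) has_vector_derivative d) (at t within I) \<and>
           norm (d - ?fb (q t)) \<le> C / sqrt \<omega>"
  proof (rule near_identity_estimates[of ?K f g g' c' w \<theta>])
    show "continuous_on ?K f" "\<And>j. continuous_on ?K (g' j)" "\<And>j l. continuous_on ?K (c' j l)"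
      by (intro contK C1_on_continuous f g' c')+
    show "(g j has_derivative blinfun_apply (g' j x)) (at x)" if "x \<in> ?K" for j x
      using g that R(2) by blast
    show "((\<lambda>x. g' j x (g l x)) has_derivative blinfun_apply (c' j l x)) (at x)" if "x \<in> ?K" for j l x
      using c'(1) that R(2) by blast
  qed (use w in \<open>simp_all\<close>)
  have "continuous_on ?K ?fb" unfolding averaged_field_def
    by (intro contK continuous_intros C1_on_continuous f g' gC1)
  then have "uniformly_continuous_on ?K ?fb" by (simp add: compact_uniformly_continuous)
  then obtain d where d: "d > 0" "\<And>x y. x \<in> ?K \<Longrightarrow> y \<in> ?K \<Longrightarrow> dist y x < d \<Longrightarrow> dist (?fb y) (?fb x) < \<nu> / 2"
    unfolding uniformly_continuous_on_def using \<nu> by (meson half_gt_zero)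
  \<comment> \<open>\<open>\<nu> / 2\<close> is the share of the velocity error,
    \<open>d / 2\<close> triggers uniform continuity, and \<open>R - r\<close> keeps
    \<open>z\<close> in the larger ball.\<close>
  define \<mu> where "\<mu> = min (min (\<nu> / 2) (d / 2)) (R - r)"
  have \<mu>: "\<mu> > 0" "\<mu> \<le> \<nu> / 2" "\<mu> < d" "\<mu> \<le> R - r"
    using \<nu> d(1) R(1) unfolding \<mu>_def by linarith+
  \<comment> \<open>Solves \<open>C / sqrt \<omega> \<le> \<mu>\<close>; the estimates hold from
    \<open>\<omega> = 1\<close> on.\<close>
  define \<omega>0 where "\<omega>0 = max 1 ((C / \<mu>)\<^sup>2)"
  have small: "C / sqrt \<omega> \<le> \<mu>" if "\<omega> > \<omega>0" for \<omega>
  proof -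
    have "C / \<mu> \<le> sqrt \<omega>" using that by (intro real_le_rsqrt) (auto simp: \<omega>0_def)
    moreover have "sqrt \<omega> > 0" using that by (auto simp: \<omega>0_def)
    ultimately show ?thesis using \<mu>(1) by (simp add: field_simps)
  qed
  have "tracks_averaged (oscillating_field w \<theta> f g \<omega>) \<Omega> S (cball qs r) ?fb \<nu>" if \<omega>: "\<omega> > \<omega>0" for \<omega>
    unfolding tracks_averaged_def
  proof (intro allI impI, elim conjE)
    fix t0 T q assume q: "q t0 \<in> S" "solution_on (oscillating_field w \<theta> f g \<omega>) \<Omega> {t0..T} q"
      "\<forall>t\<in>{t0..T}. q t \<in> cball qs r"
    have \<omega>1: "\<omega> \<ge> 1" using \<omega> by (auto simp: \<omega>0_def)
    let ?z = "\<lambda>s. near_identity w \<theta> g g' \<omega> s (q s)"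
    have qK: "q t \<in> ?K" if "t \<in> {t0..T}" for t using q(3) that R by fastforce
    have zq: "norm (?z t - q t) \<le> \<mu>" if "t \<in> {t0..T}" for t
      using C(2)[OF \<omega>1 qK[OF that], of t] small[OF \<omega>] by linarith
    have zK: "?z t \<in> ?K" if "t \<in> {t0..T}" for t
    proof -
      have "dist qs (?z t) \<le> dist qs (q t) + dist (?z t) (q t)" by (metis dist_commute dist_triangle)
      also have "\<dots> \<le> r + (R - r)"
        using zq[OF that] q(3) that \<mu>(4) by (intro add_mono) (auto simp: dist_norm)
      finally show ?thesis by simp
    qed
    have "\<exists>d. (?z has_vector_derivative d) (at t within {t0..T}) \<and> norm (d - ?fb (?z t)) \<le> \<nu>" if t: "t \<in> {t0..T}" for t
    proof -
      have "(q has_vector_derivative oscillating_field w \<theta> f g \<omega> t (q t)) (at t within {t0..T})"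
        using q(2) t by (simp add: solution_on_def)
      then obtain z' where z': "(?z has_vector_derivative z') (at t within {t0..T})" "norm (z' - ?fb (q t)) \<le> C / sqrt \<omega>"
        using C(3)[of \<omega> q t] \<omega>1 qK[OF t] by blast
      have "dist (?fb (q t)) (?fb (?z t)) < \<nu> / 2"
        by (rule d(2)[OF zK[OF t] qK[OF t]]) (use zq[OF t] \<mu>(3) in \<open>simp add: dist_norm norm_minus_commute\<close>)
      then have "norm (z' - ?fb (?z t)) \<le> \<nu>"
        using z'(2) small[OF \<omega>] \<mu>(2) norm_triangle_ineq[of "z' - ?fb (q t)" "?fb (q t) - ?fb (?z t)"]
        by (simp add: dist_norm)
      then show ?thesis using z' by blast
    qed
    then obtain z' where z': "\<forall>t\<in>{t0..T}. (?z has_vector_derivative z' t) (at t within {t0..T}) \<and> norm (z' t - ?fb (?z t)) \<le> \<nu>"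
      by metis
    have "\<forall>t\<in>{t0..T}. ?z t \<in> S \<and> norm (?z t - q t) \<le> \<nu> \<and>
           (?z has_vector_derivative z' t) (at t within {t0..T}) \<and> norm (z' t - ?fb (?z t)) \<le> \<nu>"
      using z' zq inv[OF q(1,2)] \<mu>(2) \<nu> by fastforce
    then show "\<exists>z z'. \<forall>t\<in>{t0..T}. z t \<in> S \<and> norm (z t - q t) \<le> \<nu> \<and>
           (z has_vector_derivative z' t) (at t within {t0..T}) \<and> norm (z' t - ?fb (z t)) \<le> \<nu>"
      by (intro exI[of _ ?z] exI[of _ z'])
  qed
  moreover have "\<omega>0 > 0" by (auto simp: \<omega>0_def)
  ultimately show ?thesis by blast
qed

text \<open>The index \<open>(p, False)\<close> stands for a cosine, \<open>(p, True)\<close> for a sine of frequency \<open>w p\<close>, so the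
  averaged field contains the Lie bracket of the two fields belonging to \<open>p\<close>.\<close>

definition quarter_phase :: "'p \<times> bool \<Rightarrow> real" where
  "quarter_phase j = (if snd j then pi / 2 else 0)"

lemma sum_UNIV_pair_bool:
  "(\<Sum>j\<in>(UNIV :: ('p::finite \<times> bool) set). h j) = (\<Sum>p\<in>UNIV. h (p, False) + h (p, True))"
  for h :: "_ \<Rightarrow> 'b::comm_monoid_add"
proof -
  have "(\<Sum>j\<in>(UNIV :: ('p \<times> bool) set). h j) = (\<Sum>j\<in>UNIV \<times> UNIV. h j)" by simp
  also have "\<dots> = (\<Sum>p\<in>UNIV. \<Sum>b\<in>UNIV. h (p, b))" by (simp only: sum.cartesian_product case_prod_eta)
  also have "\<dots> = (\<Sum>p\<in>UNIV. h (p, False) + h (p, True))" by (simp add: UNIV_bool)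
  finally show ?thesis .
qed

text \<open>\<open>resonance\<close> survives only for equal frequencies, which by injectivity means
  equal \<open>p\<close>, and for different phases, where it is \<open>1 / (2 * w p)\<close> up to
  sign. With the convention \<open>[g, h] = h' g - g' h\<close> this adds
  \<open>[g (p, False), g (p, True)] / (2 * w p)\<close> to the drift.\<close>

lemma averaged_field_Lie_brackets:
  fixes w :: "'p::finite \<Rightarrow> real" and g :: "'p \<times> bool \<Rightarrow> 'a::real_normed_vector \<Rightarrow> 'a"
  assumes "inj w"
  shows "averaged_field (w \<circ> fst) quarter_phase f g g' x = f x
     - (\<Sum>p\<in>UNIV. (1 / (2 * w p)) *\<^sub>R (g' (p, False) x (g (p, True) x) - g' (p, True) x (g (p, False) x)))"
proof -
  have res: "resonance (w \<circ> fst) quarter_phase (p, a) (p', b) =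
      (if p = p' then (if a = b then 0 else if b then 1 / (2 * w p) else - 1 / (2 * w p)) else 0)" for p p' a b
    using inj_eq[OF assms] by (auto simp: resonance_def quarter_phase_def)
  have inner: "(\<Sum>l\<in>UNIV. resonance (w \<circ> fst) quarter_phase (p, a) l *\<^sub>R v l)
      = (if a then - 1 / (2 * w p) else 1 / (2 * w p)) *\<^sub>R v (p, \<not> a)" for p a and v :: "_ \<Rightarrow> 'a"
  proof -
    have "(\<Sum>l\<in>UNIV. resonance (w \<circ> fst) quarter_phase (p, a) l *\<^sub>R v l)
       = (\<Sum>p'\<in>UNIV. if p = p' then (if a then - 1 / (2 * w p) else 1 / (2 * w p)) *\<^sub>R v (p', \<not> a) else 0)"
      unfolding sum_UNIV_pair_bool res by (intro sum.cong) (auto)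
    then show ?thesis by simp
  qed
  have "(\<Sum>j\<in>UNIV. \<Sum>l\<in>UNIV. resonance (w \<circ> fst) quarter_phase j l *\<^sub>R g' j x (g l x))
      = (\<Sum>j\<in>UNIV. (if snd j then - 1 / (2 * w (fst j)) else 1 / (2 * w (fst j))) *\<^sub>R g' j x (g (fst j, \<not> snd j) x))"
  proof (rule sum.cong[OF refl])
    fix j :: "'p \<times> bool"
    show "(\<Sum>l\<in>UNIV. resonance (w \<circ> fst) quarter_phase j l *\<^sub>R g' j x (g l x))
      = (if snd j then - 1 / (2 * w (fst j)) else 1 / (2 * w (fst j))) *\<^sub>R g' j x (g (fst j, \<not> snd j) x)"
      using inner[of "fst j" "snd j" "\<lambda>l. g' j x (g l x)"] by simp
  qed
  then show ?thesis by (simp add: averaged_field_def sum_UNIV_pair_bool scaleR_diff_right)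
qed

section \<open>The extremum seeking system\<close>

lemma sum_UNIV_Plus: "(\<Sum>p\<in>(UNIV :: ('p::finite + 'q::finite) set). h p) = (\<Sum>i\<in>UNIV. h (Inl i)) + (\<Sum>i\<in>UNIV. h (Inr i))"
  for h :: "_ \<Rightarrow> 'b::comm_monoid_add"
  using sum.Plus[of UNIV UNIV h] by (simp add: UNIV_Plus_UNIV)

text \<open>Uniqueness of the derivative identifies \<open>DV\<close> with a continuous
  operator-valued map, which is bounded on a compact set.\<close>

lemma C1_on_derivative_bounded:
  fixes V :: "'a::euclidean_space \<Rightarrow> 'b::real_normed_vector"
  assumes "C1_on \<Omega> V" "compact K" "K \<subseteq> \<Omega>" "\<And>z. z \<in> K \<Longrightarrow> (V has_derivative DV z) (at z)"
  obtains M where "\<And>z h. z \<in> K \<Longrightarrow> norm (DV z h) \<le> M * norm h"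
proof -
  obtain V' where V': "\<And>x. x \<in> \<Omega> \<Longrightarrow> (V has_derivative blinfun_apply (V' x)) (at x)" "continuous_on \<Omega> V'"
    using C1_onE[OF assms(1)] by blast
  obtain M where M: "\<And>z. z \<in> K \<Longrightarrow> norm (V' z) \<le> M"
    using continuous_family_bounded[of K "\<lambda>_::unit. V'"] assms(2) continuous_on_subset[OF V'(2) assms(3)] by metis
  show thesis
  proof
    fix z h assume z: "z \<in> K"
    have "DV z = blinfun_apply (V' z)" using has_derivative_unique[OF assms(4)[OF z] V'(1)] z assms(3) by blast
    then have "norm (DV z h) \<le> norm (V' z) * norm h" by (simp add: norm_blinfun)
    also have "\<dots> \<le> M * norm h" using M[OF z] by (rule mult_right_mono) simp
    finally show "norm (DV z h) \<le> M * norm h" .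
  qed
qed

lemma C2_on_UNIV_imp_DERIV:
  fixes f :: "real \<Rightarrow> real" assumes "C2_on UNIV f" shows "(f has_real_derivative deriv f y) (at y)"
proof -
  obtain f' where "\<forall>x\<in>UNIV. (f has_derivative blinfun_apply (f' x)) (at x)"
    using assms unfolding C2_on_iff by (elim exE conjE)
  then have "f differentiable (at y)" unfolding differentiable_def by (meson UNIV_I)
  then show ?thesis by (simp add: DERIV_deriv_iff_real_differentiable)
qed

locale es_system =
  fixes D :: "(real ^ 'n::finite) set" and xs :: "real ^ 'n" and J :: "real ^ 'n \<Rightarrow> real"
    and J' :: "real ^ 'n \<Rightarrow> ((real ^ 'n) \<Rightarrow>\<^sub>L real)"
    and \<phi>1 \<phi>2 \<psi>11 \<psi>12 \<psi>21 \<psi>22 :: "real \<Rightarrow> real"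
    and \<epsilon> :: real and \<alpha> \<beta> \<gamma> :: "'n \<Rightarrow> real" and k l1 l2 :: "'n \<Rightarrow> nat"
  assumes D: "open D" and xs: "xs \<in> D"
    and J_C2: "C2_on D J"
    and J': "\<And>x. x \<in> D \<Longrightarrow> (J has_derivative blinfun_apply (J' x)) (at x)" and J'_C1: "C1_on D J'"
    and J_min: "\<And>x. x \<in> D - {xs} \<Longrightarrow> J x > J xs"
    and J_crit: "\<And>x. x \<in> D \<Longrightarrow> GDERIV J x :> 0 \<longleftrightarrow> x = xs"
    and \<phi>_C2: "C2_on UNIV \<phi>1" "C2_on UNIV \<phi>2"
    and \<psi>_C2: "C2_on UNIV \<psi>11" "C2_on UNIV \<psi>12" "C2_on UNIV \<psi>21" "C2_on UNIV \<psi>22"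
    and \<phi>_bracket: "\<And>y. bracket \<phi>1 \<phi>2 y = - 1"
    and \<psi>_sum: "\<And>y. \<psi>11 y * deriv \<psi>21 y + \<psi>12 y * deriv \<psi>22 y = 1"
    and \<epsilon>: "\<epsilon> > 0" and \<alpha>: "\<And>i. \<alpha> i > 0" and \<beta>: "\<And>i. \<beta> i > 0" and \<gamma>: "\<And>i. \<gamma> i > 0"
    and freq_pos: "\<And>i. k i > 0" "\<And>i. l1 i > 0" "\<And>i. l2 i > 0"
    and freq_inj: "inj k" "inj l1" "inj l2"
    and freq_disj: "range k \<inter> range l1 = {}" "range k \<inter> range l2 = {}" "range l1 \<inter> range l2 = {}"
begin

section \<open>The system as an oscillating field with constant dither directions\<close>

definition freq :: "'n + 'n + 'n \<Rightarrow> real" where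
  "freq p = real (case_sum k (case_sum l1 l2) p)"

text \<open>Chosen so that \<open>(amp p)\<^sup>2 / (2 * freq p)\<close>, the factor produced by
  averaging, is exactly the gain \<open>\<alpha> i\<close> or \<open>\<gamma> i\<close>.\<close>

definition amp :: "'n + 'n + 'n \<Rightarrow> real" where
  "amp p = sqrt (2 * case_sum \<alpha> (case_sum \<gamma> \<gamma>) p * freq p)"

definition inner_fun :: "'n + 'n + 'n \<Rightarrow> 'n state \<Rightarrow> real" where
  "inner_fun p q = (case p of Inl i \<Rightarrow> J (fst q) * (1 / sqrt (fst (snd q) $ i + \<epsilon>)) | Inr _ \<Rightarrow> J (fst q))"

definition outer_fun :: "('n + 'n + 'n) \<times> bool \<Rightarrow> real \<Rightarrow> real" where
  "outer_fun j = (case j of (Inl _, b) \<Rightarrow> (if b then \<phi>2 else \<phi>1)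
     | (Inr (Inl _), b) \<Rightarrow> (if b then \<psi>21 else \<psi>11)
     | (Inr (Inr _), b) \<Rightarrow> (if b then \<psi>22 else \<psi>12))"

text \<open>At a frequency \<open>Inl i\<close> both phases act on \<open>x\<close>. At the other
  frequencies the cosine acts on \<open>x\<close> and the sine on \<open>\<eta>\<close>, which
  carries the bracket into the \<eta>-equation.\<close>

definition dir :: "('n + 'n + 'n) \<times> bool \<Rightarrow> 'n state" where
  "dir j = (case j of (Inl i, _) \<Rightarrow> (axis i 1, 0, 0)
     | (Inr p, b) \<Rightarrow> (let e = axis (case_sum id id p) 1 in if b then (0, 0, e) else (e, 0, 0)))"

text \<open>A scalar function times a constant direction: every value of the derivative is a
  multiple of \<open>dir j\<close>, which reduces the brackets to scalar computations.\<close>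

definition dither :: "('n + 'n + 'n) \<times> bool \<Rightarrow> 'n state \<Rightarrow> 'n state" where
  "dither j q = (amp (fst j) * outer_fun j (inner_fun (fst j) q)) *\<^sub>R dir j"

definition drift :: "'n state \<Rightarrow> 'n state" where
  "drift = (\<lambda>(x, v, \<eta>). (0, \<chi> i. - \<beta> i * (v $ i - (\<eta> $ i)\<^sup>2), \<chi> i. - \<gamma> i * \<eta> $ i))"

abbreviation dJ :: "'n \<Rightarrow> real ^ 'n \<Rightarrow> real" where "dJ i x \<equiv> blinfun_apply (J' x) (axis i 1)"

abbreviation \<Omega> :: "'n state set" where "\<Omega> \<equiv> es_domain D \<epsilon>"

definition es_averaged :: "'n state \<Rightarrow> 'n state" where
  "es_averaged = (\<lambda>(x, v, \<eta>). (\<chi> i. - \<alpha> i * dJ i x / sqrt (v $ i + \<epsilon>),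
     \<chi> i. - \<beta> i * (v $ i - (\<eta> $ i)\<^sup>2), \<chi> i. - \<gamma> i * (\<eta> $ i - dJ i x)))"

lemma freq_simps [simp]: "freq (Inl i) = real (k i)" "freq (Inr (Inl i)) = real (l1 i)" "freq (Inr (Inr i)) = real (l2 i)"
  by (simp_all add: freq_def)

lemma freq_gt_0: "freq p > 0"
  using freq_pos by (auto simp: freq_def split: sum.split)

lemma inj_freq: "inj freq"
proof -
  have "k i \<noteq> l1 m" "k i \<noteq> l2 m" "l1 i \<noteq> l2 m" for i m using freq_disj by blast+
  moreover have "l1 m \<noteq> k i" "l2 m \<noteq> k i" "l2 m \<noteq> l1 i" for i m using freq_disj by blast+
  ultimately show ?thesis using freq_inj unfolding freq_def inj_def by (auto split: sum.split)
qed

lemma sum_axis_expansion: "(\<Sum>i\<in>UNIV. a i *\<^sub>R (axis i 1 :: real ^ 'm)) = (\<chi> i. a i)"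
  by (simp add: vec_eq_iff axis_def if_distrib[of "\<lambda>x. a _ * x"] cong: if_cong)

lemma sum_axis:
  "(\<Sum>i\<in>UNIV. a i *\<^sub>R ((axis i 1, 0, 0) :: 'n state)) = (\<chi> i. a i, 0, 0)"
  "(\<Sum>i\<in>UNIV. a i *\<^sub>R ((0, 0, axis i 1) :: 'n state)) = (0, 0, \<chi> i. a i)"
  unfolding prod_eq_iff fst_sum snd_sum fst_scaleR snd_scaleR fst_conv snd_conv sum_axis_expansion by simp_all

lemma dir_simps [simp]: "dir (Inl i, b) = (axis i 1, 0, 0)"
  "dir (Inr (Inl i), False) = (axis i 1, 0, 0)" "dir (Inr (Inl i), True) = (0, 0, axis i 1)"
  "dir (Inr (Inr i), False) = (axis i 1, 0, 0)" "dir (Inr (Inr i), True) = (0, 0, axis i 1)"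
  by (simp_all add: dir_def)

lemma outer_fun_simps [simp]: "outer_fun (Inl i, False) = \<phi>1" "outer_fun (Inl i, True) = \<phi>2"
  "outer_fun (Inr (Inl i), False) = \<psi>11" "outer_fun (Inr (Inl i), True) = \<psi>21"
  "outer_fun (Inr (Inr i), False) = \<psi>12" "outer_fun (Inr (Inr i), True) = \<psi>22"
  by (simp_all add: outer_fun_def)

lemma dither_sum:
  "(\<Sum>j\<in>UNIV. c j *\<^sub>R dither j q) =
    (\<chi> i. amp (Inl i) * (\<phi>1 (inner_fun (Inl i) q) * c (Inl i, False) + \<phi>2 (inner_fun (Inl i) q) * c (Inl i, True))
        + (amp (Inr (Inl i)) * \<psi>11 (J (fst q)) * c (Inr (Inl i), False)
         + amp (Inr (Inr i)) * \<psi>12 (J (fst q)) * c (Inr (Inr i), False)), 0,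
     \<chi> i. amp (Inr (Inl i)) * \<psi>21 (J (fst q)) * c (Inr (Inl i), True)
         + amp (Inr (Inr i)) * \<psi>22 (J (fst q)) * c (Inr (Inr i), True))"
proof -
  have "inner_fun (Inr p) q = J (fst q)" for p by (simp add: inner_fun_def)
  then show ?thesis
    unfolding sum_UNIV_pair_bool sum_UNIV_Plus dither_def fst_conv dir_simps outer_fun_simps scaleR_scaleR
      sum.distrib sum_axis
    by (simp add: vec_eq_iff algebra_simps)
qed

text \<open>\<open>sqrt \<omega>\<close> is split off the amplitudes, and each sine is read as a
  cosine with phase \<open>pi / 2\<close>.\<close>

lemma field_eq: "es_field J \<phi>1 \<phi>2 \<psi>11 \<psi>12 \<psi>21 \<psi>22 \<epsilon> \<alpha> \<beta> \<gamma> k l1 l2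
  = oscillating_field (freq \<circ> fst) quarter_phase drift dither"
proof (intro ext)
  fix \<omega> t :: real and q :: "'n state"
  obtain x v \<eta> where q: "q = (x, v, \<eta>)" by (cases q)
  show "es_field J \<phi>1 \<phi>2 \<psi>11 \<psi>12 \<psi>21 \<psi>22 \<epsilon> \<alpha> \<beta> \<gamma> k l1 l2 \<omega> t q
      = oscillating_field (freq \<circ> fst) quarter_phase drift dither \<omega> t q"
    unfolding q es_field_def oscillating_field_def drift_def dither_sum
    by (simp add: vec_eq_iff inner_fun_def amp_def quarter_phase_def real_sqrt_mult cos_diff)
      (simp add: algebra_simps)
qed

section \<open>Regularity of drift and dithers\<close>

lemma open_\<Omega>: "open \<Omega>"
proof -
  have "\<Omega> = fst -` D \<inter> (\<Inter>i. {q. - \<epsilon> < fst (snd q) $ i})" by (auto simp: es_domain_def)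
  moreover have "open (fst -` D :: 'n state set)" using open_vimage_fst[OF D] .
  moreover have "open (\<Inter>i. {q :: 'n state. - \<epsilon> < fst (snd q) $ i})"
    by (intro open_INT finite ballI open_Collect_less continuous_intros)
  ultimately show ?thesis by auto
qed

lemma bounded_linear_coords:
  "bounded_linear (\<lambda>q :: 'n state. fst q)" "bounded_linear (\<lambda>q :: 'n state. fst (snd q) $ i)"
  "bounded_linear (\<lambda>q :: 'n state. snd (snd q) $ i)"
  by (rule bounded_linear_fst,
      rule bounded_linear_compose[OF bounded_linear_vec_nth bounded_linear_compose[OF bounded_linear_fst bounded_linear_snd]],
      rule bounded_linear_compose[OF bounded_linear_vec_nth bounded_linear_compose[OF bounded_linear_snd bounded_linear_snd]])

lemma C2_on_J_fst: "C2_on \<Omega> (\<lambda>q. J (fst q))"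
  by (rule C2_on_compose[OF C2_on_linear J_C2]) (auto simp: es_domain_def bounded_linear_fst)

lemma shifted_pos: assumes "q \<in> \<Omega>" shows "fst (snd q) $ i + \<epsilon> > 0"
proof -
  have "- \<epsilon> < fst (snd q) $ i" using assms by (auto simp: es_domain_def)
  then show ?thesis by simp
qed

lemma C2_on_gain: "C2_on \<Omega> (\<lambda>q. 1 / sqrt (fst (snd q) $ i + \<epsilon>))"
  by (rule C2_on_compose[OF C2_on_add[OF C2_on_linear C2_on_const] C2_on_inverse_sqrt])
    (simp_all add: image_subset_iff shifted_pos bounded_linear_coords)

lemma C2_on_inner_fun: "C2_on \<Omega> (inner_fun p)"
  unfolding inner_fun_def[abs_def]
  by (cases p) (simp_all only: sum.case C2_on_mult C2_on_J_fst C2_on_gain)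

lemma C2_on_outer_fun: "C2_on UNIV (outer_fun j)"
  using \<phi>_C2 \<psi>_C2 by (auto simp: outer_fun_def split: prod.split sum.split)

text \<open>The averaged field uses the first derivative, and differentiating the near-identity
  transformation uses the second.\<close>

lemma C2_on_dither: "C2_on \<Omega> (dither j)"
  unfolding dither_def[abs_def]
  by (intro C2_on_bounded_linear[OF bounded_linear_scaleR_left] C2_on_mult C2_on_const
      C2_on_compose[OF C2_on_inner_fun C2_on_outer_fun] subset_UNIV)

lemma C1_on_coord: "C1_on \<Omega> (\<lambda>q. fst (snd q) $ i)" "C1_on \<Omega> (\<lambda>q. snd (snd q) $ i)"
  by (auto intro!: C2_on_imp_C1_on C2_on_linear bounded_linear_coords)

lemma C1_on_sum:
  fixes h :: "'i \<Rightarrow> 'a::euclidean_space \<Rightarrow> 'b::real_normed_vector"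
  assumes "\<And>i. i \<in> A \<Longrightarrow> C1_on S (h i)"
  shows "C1_on S (\<lambda>x. \<Sum>i\<in>A. h i x)"
  using assms by (induction A rule: infinite_finite_induct) (auto intro: C1_on_const C1_on_add)

lemma C1_on_drift: "C1_on \<Omega> drift"
proof -
  have eq: "drift = (\<lambda>q. \<Sum>i\<in>UNIV. (- \<beta> i * (fst (snd q) $ i + (-1) * (snd (snd q) $ i * snd (snd q) $ i))) *\<^sub>R (0, axis i 1, 0)
      + (- \<gamma> i * snd (snd q) $ i) *\<^sub>R (0, 0, axis i 1))"
    by (auto simp: drift_def fun_eq_iff prod_eq_iff fst_sum snd_sum vec_eq_iff axis_def power2_eq_square
        if_distrib if_distribR cong: if_cong)
  show ?thesis unfolding eq
    by (intro C1_on_sum C1_on_add C1_on_bounded_linear[OF bounded_linear_scaleR_left]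
        C1_on_bilinear[OF bounded_bilinear_mult] C1_on_const C1_on_coord)
qed

section \<open>Derivatives of the dithers and their brackets\<close>

lemma J_fst_has_derivative:
  assumes "q \<in> \<Omega>" shows "((\<lambda>q. J (fst q)) has_derivative (\<lambda>h. J' (fst q) (fst h))) (at q)"
proof -
  have "fst q \<in> D" using assms by (auto simp: es_domain_def)
  from diff_chain_at[OF has_derivative_fst[OF has_derivative_ident] J'[OF this]] show ?thesis by (simp add: o_def)
qed

text \<open>Brackets evaluate the derivative in the x- and \<eta>-directions only, as no dither
  moves \<open>v\<close>; so the derivative \<open>B\<close> of the inverse square root can stay
  abstract.\<close>

lemma inner_fun_has_derivative:
  assumes q: "q \<in> \<Omega>"
  obtains d where "(inner_fun p has_derivative d) (at q)"
    "\<And>i. d (axis i 1, 0, 0) = dJ i (fst q) * (case p of Inl m \<Rightarrow> 1 / sqrt (fst (snd q) $ m + \<epsilon>) | Inr _ \<Rightarrow> 1)"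
    "\<And>y. d (0, 0, y) = 0"
proof -
  note J = J_fst_has_derivative[OF q]
  show thesis
  proof (cases p)
    case (Inl m)
    have pos: "fst (snd q) $ m + \<epsilon> \<in> {0<..}" using shifted_pos[OF q] by simp
    obtain B where "((\<lambda>s. 1 / sqrt s) has_derivative blinfun_apply B) (at (fst (snd q) $ m + \<epsilon>))"
      using C2_on_inverse_sqrt pos unfolding C2_on_def by blast
    from diff_chain_at[OF has_derivative_add_const[OF bounded_linear_imp_has_derivative[OF bounded_linear_coords(2)]] this]
    have "((\<lambda>q. 1 / sqrt (fst (snd q) $ m + \<epsilon>)) has_derivative (\<lambda>h. B (fst (snd h) $ m))) (at q)" by (simp add: o_def)
    from has_derivative_mult[OF J this]
    have "(inner_fun p has_derivative (\<lambda>h. J (fst q) * B (fst (snd h) $ m)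
        + J' (fst q) (fst h) * (1 / sqrt (fst (snd q) $ m + \<epsilon>)))) (at q)"
      by (simp add: inner_fun_def[abs_def] Inl)
    then show thesis by (rule that) (simp_all add: Inl blinfun.zero_right)
  next
    case (Inr p')
    then show thesis using that[of "\<lambda>h. J' (fst q) (fst h)"] J
      by (simp add: inner_fun_def[abs_def] blinfun.bilinear_simps)
  qed
qed

lemma dither_derivative_dir:
  assumes q: "q \<in> \<Omega>" and der: "(dither j has_derivative g') (at q)"
  shows "g' (axis i 1, 0, 0) = (amp (fst j) * deriv (outer_fun j) (inner_fun (fst j) q)
        * (dJ i (fst q) * (case fst j of Inl m \<Rightarrow> 1 / sqrt (fst (snd q) $ m + \<epsilon>) | Inr _ \<Rightarrow> 1))) *\<^sub>R dir j"
    and "g' (0, 0, y) = 0"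
    and "\<exists>c. g' h = c *\<^sub>R dir j"
proof -
  obtain d where d: "(inner_fun (fst j) has_derivative d) (at q)"
    "\<And>i. d (axis i 1, 0, 0) = dJ i (fst q) * (case fst j of Inl m \<Rightarrow> 1 / sqrt (fst (snd q) $ m + \<epsilon>) | Inr _ \<Rightarrow> 1)"
    "\<And>y. d (0, 0, y) = 0"
    using inner_fun_has_derivative[OF q] by blast
  let ?o = "deriv (outer_fun j) (inner_fun (fst j) q)"
  have "(outer_fun j has_derivative (\<lambda>h. ?o * h)) (at (inner_fun (fst j) q))"
    using C2_on_UNIV_imp_DERIV[OF C2_on_outer_fun] by (simp add: has_field_derivative_def)
  from diff_chain_at[OF d(1) this]
  have "((\<lambda>q. outer_fun j (inner_fun (fst j) q)) has_derivative (\<lambda>h. ?o * d h)) (at q)" by (simp add: o_def)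
  then have "(dither j has_derivative (\<lambda>h. (amp (fst j) * (?o * d h)) *\<^sub>R dir j)) (at q)"
    unfolding dither_def[abs_def] by (intro has_derivative_scaleR_left has_derivative_mult_right)
  then have g': "g' = (\<lambda>h. (amp (fst j) * (?o * d h)) *\<^sub>R dir j)" using has_derivative_unique[OF der] by blast
  show "g' (axis i 1, 0, 0) = (amp (fst j) * ?o
        * (dJ i (fst q) * (case fst j of Inl m \<Rightarrow> 1 / sqrt (fst (snd q) $ m + \<epsilon>) | Inr _ \<Rightarrow> 1))) *\<^sub>R dir j"
    by (simp add: g' d(2) mult.assoc)
  show "g' (0, 0, y) = 0" "\<exists>c. g' h = c *\<^sub>R dir j" by (auto simp: g' d(3))
qed

lemma amp_square: "amp (Inl i) * amp (Inl i) = 2 * \<alpha> i * real (k i)"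
   "amp (Inr (Inl i)) * amp (Inr (Inl i)) = 2 * \<gamma> i * real (l1 i)"
   "amp (Inr (Inr i)) * amp (Inr (Inr i)) = 2 * \<gamma> i * real (l2 i)"
proof -
  have "0 \<le> \<alpha> i" "0 \<le> \<gamma> i" using \<alpha>[of i] \<gamma>[of i] by simp_all
  then have "0 \<le> 2 * \<alpha> i * real (k i)" "0 \<le> 2 * \<gamma> i * real (l1 i)" "0 \<le> 2 * \<gamma> i * real (l2 i)" by simp_all
  then show "amp (Inl i) * amp (Inl i) = 2 * \<alpha> i * real (k i)"
   "amp (Inr (Inl i)) * amp (Inr (Inl i)) = 2 * \<gamma> i * real (l1 i)"
   "amp (Inr (Inr i)) * amp (Inr (Inr i)) = 2 * \<gamma> i * real (l2 i)"
    unfolding amp_def freq_simps sum.case real_sqrt_mult_self by (simp_all only: abs_of_nonneg)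
qed

text \<open>For a \<phi>-pair both fields point along the same x-axis and the bracket collapses to
  the Wronskian of \<open>\<phi>1\<close> and \<open>\<phi>2\<close>; as this is constant, the value
  of \<open>J\<close> drops out and only its partial derivative remains. In a \<psi>-pair neither
  field depends on \<open>\<eta>\<close>, along which the sine field points, so one half of the
  bracket vanishes; the remaining halves of the two \<psi>-pairs add up by
  \<open>\<psi>_sum\<close>.\<close>

lemma dither_averaged_field:
  assumes q: "q \<in> \<Omega>" and g': "\<And>j. (dither j has_derivative blinfun_apply (g' j q)) (at q)"
  shows "averaged_field (freq \<circ> fst) quarter_phase drift dither g' q = es_averaged q"
proof -
  let ?L = "\<lambda>p. g' (p, False) q (dither (p, True) q) - g' (p, True) q (dither (p, False) q)"
  note g'x = dither_derivative_dir(1)[OF q g'] and g'\<eta> = dither_derivative_dir(2)[OF q g']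
  have phi: "deriv \<phi>1 y * \<phi>2 y - deriv \<phi>2 y * \<phi>1 y = 1" for y
    using \<phi>_bracket[of y] by (simp add: bracket_def algebra_simps)
  have L1: "(1 / (2 * freq (Inl i))) *\<^sub>R ?L (Inl i) = (\<alpha> i * dJ i (fst q) / sqrt (fst (snd q) $ i + \<epsilon>)) *\<^sub>R (axis i 1, 0, 0)" for i
  proof -
    let ?y = "inner_fun (Inl i) q" and ?a = "amp (Inl i)" and ?s = "dJ i (fst q) * (1 / sqrt (fst (snd q) $ i + \<epsilon>))"
    let ?e = "(axis i 1, 0, 0) :: 'n state"
    have 1: "g' (Inl i, False) q (dither (Inl i, True) q) = (?a * \<phi>2 ?y) *\<^sub>R (?a * deriv \<phi>1 ?y * ?s) *\<^sub>R ?e"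
      using g'x[of "(Inl i, False)" i] by (simp only: dither_def dir_def outer_fun_def blinfun.scaleR_right prod.case sum.case fst_conv if_True if_False)
    have 2: "g' (Inl i, True) q (dither (Inl i, False) q) = (?a * \<phi>1 ?y) *\<^sub>R (?a * deriv \<phi>2 ?y * ?s) *\<^sub>R ?e"
      using g'x[of "(Inl i, True)" i] by (simp only: dither_def dir_def outer_fun_def blinfun.scaleR_right prod.case sum.case fst_conv if_True if_False)
    have "(1 / (2 * freq (Inl i))) *\<^sub>R ?L (Inl i)
        = (1 / (2 * real (k i)) * (?a * \<phi>2 ?y * (?a * deriv \<phi>1 ?y * ?s) - ?a * \<phi>1 ?y * (?a * deriv \<phi>2 ?y * ?s))) *\<^sub>R ?e"
      unfolding 1 2 scaleR_scaleR scaleR_diff_left[symmetric] freq_simps ..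
    also have "1 / (2 * real (k i)) * (?a * \<phi>2 ?y * (?a * deriv \<phi>1 ?y * ?s) - ?a * \<phi>1 ?y * (?a * deriv \<phi>2 ?y * ?s))
        = 1 / (2 * real (k i)) * (?a * ?a) * ?s * (deriv \<phi>1 ?y * \<phi>2 ?y - deriv \<phi>2 ?y * \<phi>1 ?y)"
      by (simp only: algebra_simps)
    also have "\<dots> = \<alpha> i * dJ i (fst q) / sqrt (fst (snd q) $ i + \<epsilon>)"
      unfolding phi amp_square using freq_pos(1)[of i] by simp
    finally show ?thesis .
  qed
  have L2: "(1 / (2 * freq (Inr (Inl i)))) *\<^sub>R ?L (Inr (Inl i))
      = (- \<gamma> i * dJ i (fst q) * (\<psi>11 (J (fst q)) * deriv \<psi>21 (J (fst q)))) *\<^sub>R (0, 0, axis i 1)" for i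
  proof -
    let ?y = "inner_fun (Inr (Inl i)) q" and ?a = "amp (Inr (Inl i))" and ?s = "dJ i (fst q) * 1"
    let ?e = "(0, 0, axis i 1) :: 'n state"
    have 1: "g' (Inr (Inl i), False) q (dither (Inr (Inl i), True) q) = (?a * \<psi>21 ?y) *\<^sub>R 0"
      using g'\<eta>[of "(Inr (Inl i), False)" "axis i 1"]
      by (simp only: dither_def dir_def outer_fun_def blinfun.scaleR_right prod.case sum.case fst_conv if_True if_False Let_def id_apply)
    have 2: "g' (Inr (Inl i), True) q (dither (Inr (Inl i), False) q) = (?a * \<psi>11 ?y) *\<^sub>R (?a * deriv \<psi>21 ?y * ?s) *\<^sub>R ?e"
      using g'x[of "(Inr (Inl i), True)" i]
      by (simp only: dither_def dir_def outer_fun_def blinfun.scaleR_right prod.case sum.case fst_conv if_True if_False Let_def id_apply)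
    have "(1 / (2 * freq (Inr (Inl i)))) *\<^sub>R ?L (Inr (Inl i))
        = (- (1 / (2 * real (l1 i)) * (?a * \<psi>11 ?y * (?a * deriv \<psi>21 ?y * ?s)))) *\<^sub>R ?e"
      unfolding 1 2 scaleR_scaleR freq_simps scaleR_zero_right diff_0 scaleR_minus_right scaleR_minus_left ..
    also have "- (1 / (2 * real (l1 i)) * (?a * \<psi>11 ?y * (?a * deriv \<psi>21 ?y * ?s)))
        = - (1 / (2 * real (l1 i)) * (?a * ?a) * ?s * (\<psi>11 ?y * deriv \<psi>21 ?y))"
      by (simp only: algebra_simps)
    also have "\<dots> = - \<gamma> i * dJ i (fst q) * (\<psi>11 (J (fst q)) * deriv \<psi>21 (J (fst q)))"
      unfolding amp_square inner_fun_def using freq_pos(2)[of i] by simp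
    finally show ?thesis .
  qed
  have L3: "(1 / (2 * freq (Inr (Inr i)))) *\<^sub>R ?L (Inr (Inr i))
      = (- \<gamma> i * dJ i (fst q) * (\<psi>12 (J (fst q)) * deriv \<psi>22 (J (fst q)))) *\<^sub>R (0, 0, axis i 1)" for i
  proof -
    let ?y = "inner_fun (Inr (Inr i)) q" and ?a = "amp (Inr (Inr i))" and ?s = "dJ i (fst q) * 1"
    let ?e = "(0, 0, axis i 1) :: 'n state"
    have 1: "g' (Inr (Inr i), False) q (dither (Inr (Inr i), True) q) = (?a * \<psi>22 ?y) *\<^sub>R 0"
      using g'\<eta>[of "(Inr (Inr i), False)" "axis i 1"]
      by (simp only: dither_def dir_def outer_fun_def blinfun.scaleR_right prod.case sum.case fst_conv if_True if_False Let_def id_apply)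
    have 2: "g' (Inr (Inr i), True) q (dither (Inr (Inr i), False) q) = (?a * \<psi>12 ?y) *\<^sub>R (?a * deriv \<psi>22 ?y * ?s) *\<^sub>R ?e"
      using g'x[of "(Inr (Inr i), True)" i]
      by (simp only: dither_def dir_def outer_fun_def blinfun.scaleR_right prod.case sum.case fst_conv if_True if_False Let_def id_apply)
    have "(1 / (2 * freq (Inr (Inr i)))) *\<^sub>R ?L (Inr (Inr i))
        = (- (1 / (2 * real (l2 i)) * (?a * \<psi>12 ?y * (?a * deriv \<psi>22 ?y * ?s)))) *\<^sub>R ?e"
      unfolding 1 2 scaleR_scaleR freq_simps scaleR_zero_right diff_0 scaleR_minus_right scaleR_minus_left ..
    also have "- (1 / (2 * real (l2 i)) * (?a * \<psi>12 ?y * (?a * deriv \<psi>22 ?y * ?s)))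
        = - (1 / (2 * real (l2 i)) * (?a * ?a) * ?s * (\<psi>12 ?y * deriv \<psi>22 ?y))"
      by (simp only: algebra_simps)
    also have "\<dots> = - \<gamma> i * dJ i (fst q) * (\<psi>12 (J (fst q)) * deriv \<psi>22 (J (fst q)))"
      unfolding amp_square inner_fun_def using freq_pos(3)[of i] by simp
    finally show ?thesis .
  qed
  have L23: "(1 / (2 * freq (Inr (Inl i)))) *\<^sub>R ?L (Inr (Inl i)) + (1 / (2 * freq (Inr (Inr i)))) *\<^sub>R ?L (Inr (Inr i))
      = (- \<gamma> i * dJ i (fst q)) *\<^sub>R (0, 0, axis i 1)" for i
  proof -
    have "(- \<gamma> i * dJ i (fst q) * (\<psi>11 y * deriv \<psi>21 y)) + (- \<gamma> i * dJ i (fst q) * (\<psi>12 y * deriv \<psi>22 y))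
        = - \<gamma> i * dJ i (fst q)" for y
      using \<psi>_sum[of y] by (metis distrib_left mult.right_neutral)
    then show ?thesis unfolding L2 L3 scaleR_add_left[symmetric] by simp
  qed
  have "averaged_field (freq \<circ> fst) quarter_phase drift dither g' q = drift q -
      ((\<Sum>i\<in>UNIV. (\<alpha> i * dJ i (fst q) / sqrt (fst (snd q) $ i + \<epsilon>)) *\<^sub>R (axis i 1, 0, 0))
       + (\<Sum>i\<in>UNIV. (- \<gamma> i * dJ i (fst q)) *\<^sub>R (0, 0, axis i 1)))"
    unfolding averaged_field_Lie_brackets[OF inj_freq] sum_UNIV_Plus L1 L23[symmetric] sum.distrib ..
  also have "\<dots> = es_averaged q"
    by (auto simp: es_averaged_def drift_def prod_eq_iff fst_sum snd_sum vec_eq_iff axis_def algebra_simps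
        if_distrib if_distribR case_prod_beta cong: if_cong)
  finally show ?thesis .
qed

section \<open>Invariance of the admissible set\<close>

lemma dither_second_component: "fst (snd (dither j q)) = 0"
  by (auto simp: dither_def dir_def Let_def split: prod.split sum.split)

text \<open>Both corrections are combinations of vectors \<open>dir j\<close>, whose v-part is zero.
  Thus the transformed point inherits \<open>v \<ge> 0\<close> from the solution.\<close>

lemma near_identity_second_component:
  assumes q: "q \<in> \<Omega>" and g': "\<And>j. (dither j has_derivative blinfun_apply (g' j q)) (at q)"
  shows "fst (snd (near_identity w \<theta> dither g' \<omega> t q)) = fst (snd q)"
proof -
  have "fst (snd (g' j q h)) = 0" for j h
  proof -
    obtain c where "g' j q h = c *\<^sub>R dir j" using dither_derivative_dir(3)[OF q g'] by blast
    then show ?thesis by (auto simp: dir_def Let_def split: prod.split sum.split)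
  qed
  then show ?thesis
    by (simp add: near_identity_def dither_second_component fst_sum snd_sum)
qed

text \<open>Wherever a component of \<open>v\<close> is at most 0, its derivative is nonnegative,
  whatever the dithers do to \<open>\<eta>\<close>.\<close>

lemma initial_set_invariant:
  assumes "q t0 \<in> es_initial" "solution_on (oscillating_field w \<theta> drift dither \<omega>) \<Omega> {t0..T} q" "t \<in> {t0..T}"
  shows "q t \<in> es_initial"
proof -
  let ?f = "oscillating_field w \<theta> drift dither \<omega>"
  have "0 \<le> fst (snd (q t)) $ i" for i
  proof -
    let ?u = "\<lambda>s. - (fst (snd (q s)) $ i)" and ?u' = "\<lambda>s. \<beta> i * (fst (snd (q s)) $ i - (snd (snd (q s)) $ i)\<^sup>2)"
    \<comment> \<open>\<open>upper_comparison\<close> for the negated component, with level 0 and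
      rate 0.\<close>
    have "?u t \<le> max 0 (?u t0 - 0 * (t - t0))"
    proof (rule upper_comparison[where u' = ?u' and b = T])
      fix s assume s: "s \<in> {t0..T}"
      have "(q has_vector_derivative ?f s (q s)) (at s within {t0..T})"
        using assms(2) s by (simp add: solution_on_def)
      then have "((\<lambda>s. fst (snd (q s)) $ i) has_vector_derivative fst (snd (?f s (q s))) $ i) (at s within {t0..T})"
        by (rule bounded_linear.has_vector_derivative[OF bounded_linear_coords(2)])
      moreover have "fst (snd (?f s (q s))) $ i = - ?u' s"
        by (simp add: oscillating_field_def drift_def case_prod_beta dither_second_component fst_sum snd_sum)
      ultimately show "(?u has_real_derivative ?u' s) (at s within {t0..T})"
        by (auto simp: has_real_derivative_iff_has_vector_derivative dest: has_vector_derivative_minus)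
      show "?u' s \<le> - 0" if "0 \<le> ?u s"
      proof -
        have "fst (snd (q s)) $ i - (snd (snd (q s)) $ i)\<^sup>2 \<le> 0"
          using that zero_le_power2[of "snd (snd (q s)) $ i"] by linarith
        then show ?thesis using mult_nonneg_nonpos[OF less_imp_le[OF \<beta>[of i]]] by simp
      qed
    qed (use assms(3) in auto)
    then show ?thesis using assms(1) by (auto simp: es_initial_def case_prod_beta)
  qed
  then show ?thesis by (auto simp: es_initial_def case_prod_beta)
qed

text \<open>The weight \<open>A\<close> has to be so large that the decay of \<open>A * J\<close> along the averaged system, where
  \<open>v \<le> R\<close> bounds the step size from below, absorbs the gradient entering through the \<open>\<eta>\<close>-equation;
  \<open>v\<close> may enter linearly because \<open>v \<ge> 0\<close> is preserved.\<close>

definition lyap :: "real \<Rightarrow> 'n state \<Rightarrow> real" where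
  "lyap A q = A * (J (fst q) - J xs)
     + (\<Sum>i\<in>UNIV. 2 / \<gamma> i * (snd (snd q) $ i * snd (snd q) $ i) + 1 / \<beta> i * fst (snd q) $ i)"

definition lyap' :: "real \<Rightarrow> 'n state \<Rightarrow> 'n state \<Rightarrow> real" where
  "lyap' A q h = A * J' (fst q) (fst h)
     + (\<Sum>i\<in>UNIV. 4 / \<gamma> i * snd (snd q) $ i * snd (snd h) $ i + 1 / \<beta> i * fst (snd h) $ i)"

definition dissipation :: "'n state \<Rightarrow> real" where
  "dissipation q = (\<Sum>i\<in>UNIV. (dJ i (fst q))\<^sup>2 + (snd (snd q) $ i)\<^sup>2 + fst (snd q) $ i)"

section \<open>Decay and positivity of the Lyapunov function\<close>

lemma lyap_has_derivative:
  assumes "q \<in> \<Omega>" shows "(lyap A has_derivative lyap' A q) (at q)"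
  unfolding lyap_def[abs_def] lyap'_def
  by (rule derivative_eq_intros J_fst_has_derivative[OF assms] refl
      bounded_linear_imp_has_derivative[OF bounded_linear_coords(2)]
      bounded_linear_imp_has_derivative[OF bounded_linear_coords(3)])+
    (auto simp: fun_eq_iff algebra_simps intro!: sum.cong)

lemma C1_on_lyap: "C1_on \<Omega> (lyap A)"
proof -
  have eq: "lyap A = (\<lambda>q. A * (J (fst q) + (- J xs))
     + (\<Sum>i\<in>UNIV. 2 / \<gamma> i * (snd (snd q) $ i * snd (snd q) $ i) + 1 / \<beta> i * fst (snd q) $ i))"
    by (simp add: lyap_def fun_eq_iff)
  show ?thesis unfolding eq
    by (intro C1_on_add C1_on_sum C1_on_bilinear[OF bounded_bilinear_mult] C1_on_const C1_on_coord
        C2_on_imp_C1_on[OF C2_on_J_fst])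
qed

lemma continuous_on_dissipation: "continuous_on \<Omega> dissipation"
proof -
  have "continuous_on \<Omega> (\<lambda>q. J' (fst q))"
    by (rule continuous_on_compose2[OF C1_on_continuous[OF J'_C1]]) (auto simp: es_domain_def intro!: continuous_intros)
  then show ?thesis unfolding dissipation_def[abs_def] by (intro continuous_intros)
qed

lemma J'_vec: "J' x (\<chi> i. y i) = (\<Sum>i\<in>UNIV. y i * dJ i x)"
  unfolding sum_axis_expansion[symmetric] by (simp add: blinfun.sum_right blinfun.scaleR_right)

text \<open>By linearity, vanishing partial derivatives make the whole derivative zero, which is the
  form \<open>J_crit\<close> can use.\<close>

lemma gradient_zero:
  assumes "x \<in> D" "\<And>i. dJ i x = 0" shows "x = xs"
proof -
  have "J' x h = 0" for h
    using J'_vec[of x "\<lambda>i. h $ i"] assms(2) by simp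
  then have "blinfun_apply (J' x) = (\<lambda>h. 0)" by auto
  then show ?thesis using J_crit[OF assms(1)] J'[OF assms(1)] by (simp add: gderiv_def)
qed

text \<open>Per coordinate, with \<open>d\<close> the partial derivative of \<open>J\<close>: the
  \<eta>-term contributes \<open>- 4 * \<eta>^2 + 4 * \<eta> * d\<close>, the v-term
  \<open>- v + \<eta>^2\<close>, and Young's inequality bounds the mixed product by
  \<open>2 * d^2 + 2 * \<eta>^2\<close>. The weight \<open>2 / \<gamma> i\<close> thus leaves
  \<open>- \<eta>^2\<close>, while the J-term must supply \<open>- 3 * d^2\<close> to leave
  \<open>- d^2\<close>: this is the 3 in the condition on \<open>A\<close>.\<close>

lemma lyap_decay:
  assumes q: "q \<in> \<Omega>" and R: "\<And>i. fst (snd q) $ i \<le> R" and A: "\<And>i. 3 * sqrt (R + \<epsilon>) \<le> A * \<alpha> i"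
  shows "lyap' A q (es_averaged q) \<le> - dissipation q"
proof -
  obtain x v \<eta> where q_eq: "q = (x, v, \<eta>)" by (cases q)
  have termwise: "A * ((- \<alpha> i * dJ i x / sqrt (v $ i + \<epsilon>)) * dJ i x)
      + (4 / \<gamma> i * \<eta> $ i * (- \<gamma> i * (\<eta> $ i - dJ i x)) + 1 / \<beta> i * (- \<beta> i * (v $ i - (\<eta> $ i)\<^sup>2)))
      \<le> - ((dJ i x)\<^sup>2 + (\<eta> $ i)\<^sup>2 + v $ i)" for i
  proof -
    let ?d = "dJ i x" and ?e = "\<eta> $ i" and ?s = "sqrt (v $ i + \<epsilon>)"
    have s: "?s > 0" using shifted_pos[OF q, of i] by (simp add: q_eq)
    have "?s \<le> sqrt (R + \<epsilon>)" using R[of i] by (simp add: q_eq)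
    then have "3 * ?s \<le> A * \<alpha> i" using A[of i] by linarith
    then have "3 \<le> A * \<alpha> i / ?s" using s by (simp add: pos_le_divide_eq)
    then have x_decay: "- (A * \<alpha> i / ?s * ?d\<^sup>2) \<le> - (3 * ?d\<^sup>2)" using mult_right_mono[of 3 "A * \<alpha> i / ?s" "?d\<^sup>2"] by simp
    have x_eq: "A * ((- \<alpha> i * ?d / ?s) * ?d) = - (A * \<alpha> i / ?s * ?d\<^sup>2)" by (simp add: power2_eq_square)
    have \<eta>_eq: "4 / \<gamma> i * ?e * (- \<gamma> i * (?e - ?d)) = - 4 * ?e\<^sup>2 + 4 * ?e * ?d"
      using \<gamma>[of i] by (simp add: field_simps power2_eq_square)
    have v_eq: "1 / \<beta> i * (- \<beta> i * (v $ i - ?e\<^sup>2)) = - v $ i + ?e\<^sup>2"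
      using \<beta>[of i] by simp
    have young: "4 * ?e * ?d \<le> 2 * ?d\<^sup>2 + 2 * ?e\<^sup>2"
      using zero_le_power2[of "?e - ?d"] by (simp add: power2_diff)
    have "- 3 * ?d\<^sup>2 + (- 4 * ?e\<^sup>2 + 4 * ?e * ?d + (- v $ i + ?e\<^sup>2)) \<le> - (?d\<^sup>2 + ?e\<^sup>2 + v $ i)"
      using young by linarith
    then show ?thesis unfolding x_eq \<eta>_eq v_eq using x_decay by linarith
  qed
  have "lyap' A q (es_averaged q) = (\<Sum>i\<in>UNIV. A * ((- \<alpha> i * dJ i x / sqrt (v $ i + \<epsilon>)) * dJ i x)
      + (4 / \<gamma> i * \<eta> $ i * (- \<gamma> i * (\<eta> $ i - dJ i x)) + 1 / \<beta> i * (- \<beta> i * (v $ i - (\<eta> $ i)\<^sup>2))))"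
    by (simp only: lyap'_def es_averaged_def q_eq prod.case fst_conv snd_conv J'_vec vec_lambda_beta
        sum_distrib_left sum.distrib)
  also have "\<dots> \<le> (\<Sum>i\<in>UNIV. - ((dJ i x)\<^sup>2 + (\<eta> $ i)\<^sup>2 + v $ i))" by (rule sum_mono) (rule termwise)
  also have "\<dots> = - dissipation q" by (simp only: dissipation_def q_eq fst_conv snd_conv sum_negf)
  finally show ?thesis .
qed

text \<open>For \<open>x \<noteq> xs\<close> strict minimality makes \<open>lyap\<close> positive
  and \<open>gradient_zero\<close> makes \<open>dissipation\<close> positive; for
  \<open>x = xs\<close> a nonzero component of \<open>v\<close> or \<open>\<eta>\<close> does both.
  The linear v-terms have the right sign because \<open>q\<close> lies in
  \<open>es_initial\<close>.\<close>

lemma lyap_dissipation_pos: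
  assumes q: "q \<in> \<Omega>" "q \<in> es_initial" "q \<noteq> (xs, 0, 0)" and A: "A > 0"
  shows "lyap A q > 0" "dissipation q > 0"
proof -
  obtain x v \<eta> where q_eq: "q = (x, v, \<eta>)" by (cases q)
  have v: "v $ i \<ge> 0" for i using q(2) by (simp add: es_initial_def q_eq)
  have x: "x \<in> D" using q(1) by (simp add: es_domain_def q_eq)
  let ?V = "\<lambda>i. 2 / \<gamma> i * (\<eta> $ i * \<eta> $ i) + 1 / \<beta> i * v $ i"
  let ?P = "\<lambda>i. (dJ i x)\<^sup>2 + (\<eta> $ i)\<^sup>2 + v $ i"
  have V0: "?V i \<ge> 0" for i using \<gamma>[of i] \<beta>[of i] v[of i] by simp
  have P0: "?P i \<ge> 0" for i using v[of i] by simp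
  have sum_pos: "sum h UNIV > 0" if "\<And>i. h i \<ge> 0" "h i > 0" for h :: "'n \<Rightarrow> real" and i
    using that by (intro sum_pos2[of UNIV i]) auto
  have J0: "A * (J x - J xs) \<ge> 0" using J_min[of x] A x by (cases "x = xs") (auto intro: less_imp_le)
  have "lyap A q > 0 \<and> dissipation q > 0"
  proof (cases "x = xs")
    case False
    have "J x > J xs" using J_min[of x] x False by blast
    then have "A * (J x - J xs) > 0" using A by simp
    moreover have "sum ?V UNIV \<ge> 0" by (rule sum_nonneg) (rule V0)
    moreover obtain i where "dJ i x \<noteq> 0" using gradient_zero[OF x] False by blast
    then have "?P i > 0" using v[of i] by (simp add: add_pos_nonneg)
    then have "sum ?P UNIV > 0" using sum_pos[of ?P i] P0 by blast
    ultimately show ?thesis by (simp add: lyap_def dissipation_def q_eq)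
  next
    case True
    then obtain i where i: "v $ i \<noteq> 0 \<or> \<eta> $ i \<noteq> 0" using q(3) by (auto simp: q_eq vec_eq_iff)
    have "?V i > 0"
    proof (cases "\<eta> $ i = 0")
      case True
      then have "v $ i > 0" using i v[of i] by simp
      then show ?thesis using True \<beta>[of i] by simp
    next
      case False
      then have "0 < (\<eta> $ i)\<^sup>2" by simp
      then have "2 / \<gamma> i * (\<eta> $ i * \<eta> $ i) > 0" using \<gamma>[of i] by (simp add: power2_eq_square)
      moreover have "1 / \<beta> i * v $ i \<ge> 0" using \<beta>[of i] v[of i] by simp
      ultimately show ?thesis by linarith
    qed
    moreover have "?P i > 0"
    proof (cases "\<eta> $ i = 0")
      case True
      then show ?thesis using i v[of i] by (simp add: add_nonneg_pos)
    next
      case False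
      then show ?thesis using v[of i] by (simp add: add_nonneg_pos add_pos_nonneg)
    qed
    ultimately have "sum ?V UNIV > 0" "sum ?P UNIV > 0" using sum_pos[of ?V i] sum_pos[of ?P i] V0 P0 by blast+
    then show ?thesis using J0 by (simp add: lyap_def dissipation_def q_eq)
  qed
  then show "lyap A q > 0" "dissipation q > 0" by auto
qed

section \<open>Choice of radii and weight, and conclusion\<close>

lemma closed_es_initial: "closed (es_initial :: 'n state set)"
proof -
  have "es_initial = (\<Inter>i. {q :: 'n state. 0 \<le> fst (snd q) $ i})" by (auto simp: es_initial_def)
  moreover have "closed (\<Inter>i. {q :: 'n state. 0 \<le> fst (snd q) $ i})"
    by (intro closed_INT ballI closed_Collect_le continuous_intros)
  ultimately show ?thesis by simp
qed

lemma practical_stability: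
  "practically_uniformly_asymptotically_stable
     (es_field J \<phi>1 \<phi>2 \<psi>11 \<psi>12 \<psi>21 \<psi>22 \<epsilon> \<alpha> \<beta> \<gamma> k l1 l2) \<Omega> es_initial (xs, 0, 0)"
proof -
  let ?q = "(xs, 0, 0) :: 'n state"
  have "?q \<in> \<Omega>" using xs \<epsilon> by (simp add: es_domain_def)
  then obtain R where R: "R > 0" "cball ?q R \<subseteq> \<Omega>" using open_\<Omega> open_contains_cball by metis
  \<comment> \<open>The sum dominates each of its positive terms, so one weight serves every
    coordinate.\<close>
  define A where "A = (\<Sum>i\<in>UNIV. 3 * sqrt (R + \<epsilon>) / \<alpha> i)"
  have A_term: "3 * sqrt (R + \<epsilon>) / \<alpha> i > 0" for i using R(1) \<epsilon> \<alpha>[of i] by simp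
  have A: "3 * sqrt (R + \<epsilon>) \<le> A * \<alpha> i" for i
  proof -
    have "3 * sqrt (R + \<epsilon>) / \<alpha> i \<le> A" unfolding A_def
      by (rule member_le_sum) (use A_term in \<open>auto simp: less_imp_le\<close>)
    then show ?thesis using \<alpha>[of i] by (simp add: pos_divide_le_eq)
  qed
  have "A > 0" unfolding A_def by (rule sum_pos) (use A_term in auto)
  obtain M where M: "\<And>z h. z \<in> cball ?q R \<Longrightarrow> norm (lyap' A z h) \<le> M * norm h"
    using C1_on_derivative_bounded[OF C1_on_lyap compact_cball R(2), of A "lyap' A"] lyap_has_derivative R(2) by blast
  have "\<forall>j. \<exists>g'. (\<forall>x\<in>\<Omega>. (dither j has_derivative blinfun_apply (g' x)) (at x)) \<and> C1_on \<Omega> g'"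
    using C2_on_dither unfolding C2_on_iff by blast
  then obtain g' where g': "\<And>j x. x \<in> \<Omega> \<Longrightarrow> (dither j has_derivative blinfun_apply (g' j x)) (at x)"
    and g'_C1: "\<And>j. C1_on \<Omega> (g' j)" by metis
  let ?w = "freq \<circ> fst :: ('n + 'n + 'n) \<times> bool \<Rightarrow> real"
  let ?F = "oscillating_field ?w quarter_phase drift dither"
  let ?fb = "averaged_field ?w quarter_phase drift dither g'"
  \<comment> \<open>With \<open>r = R / 2\<close> the other half of the radius is room for the
    distance between \<open>q\<close> and \<open>z\<close>.\<close>
  interpret perturbed_lyapunov ?F \<Omega> es_initial ?q ?fb "lyap A" dissipation "lyap' A" "R / 2" R M
  proof
    show "0 < R / 2" "R / 2 < R" using R(1) by auto
    show "closed (es_initial :: 'n state set)" by (rule closed_es_initial)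
    show "?q \<in> es_initial" by (simp add: es_initial_def)
    show "I = {t0..}" if "maximal_solution (?F \<omega>) \<Omega> t0 I q" "\<And>t. t \<in> I \<Longrightarrow> q t \<in> cball ?q (R / 2)" for \<omega> t0 I q
    proof (rule maximal_solution_global[OF _ _ open_\<Omega> that(1) compact_cball _ that(2)])
      show "continuous_on (UNIV \<times> \<Omega>) (\<lambda>(t, x). ?F \<omega> t x)" "local_lipschitz UNIV \<Omega> (?F \<omega>)"
        by (intro C1_on_oscillating_field open_\<Omega> C1_on_drift C2_on_imp_C1_on C2_on_dither)+
      show "cball ?q (R / 2) \<subseteq> \<Omega>" using R subset_cball[of "R / 2" R ?q] by auto
    qed
    show "\<exists>\<omega>0>0. \<forall>\<omega>>\<omega>0. tracks_averaged (?F \<omega>) \<Omega> es_initial (cball ?q (R / 2)) ?fb \<nu>" if "\<nu> > 0" for \<nu>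
    proof (rule oscillating_field_tracks_averaged[OF _ R(2) C1_on_drift g' g'_C1 _ _ that])
      show "R / 2 < R" using R(1) by simp
      show "?w j > 0" for j using freq_gt_0 by simp
      fix \<omega> t0 T t and q :: "real \<Rightarrow> 'n state"
      assume q: "q t0 \<in> es_initial" "solution_on (?F \<omega>) \<Omega> {t0..T} q" "t \<in> {t0..T}"
      have "q t \<in> \<Omega>" using q(2,3) by (simp add: solution_on_def)
      from near_identity_second_component[of "q t" g', OF this g'[OF this]] initial_set_invariant[OF q]
      show "near_identity ?w quarter_phase dither g' \<omega> t (q t) \<in> es_initial"
        by (simp add: es_initial_def case_prod_beta)
    qed
    show "(lyap A has_derivative lyap' A z) (at z)" if "z \<in> cball ?q R" for z
      using lyap_has_derivative that R(2) by blast
    show "\<bar>lyap' A z h\<bar> \<le> M * norm h" if "z \<in> cball ?q R" for z h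
      using M[OF that, of h] by simp
    show "continuous_on (cball ?q R) dissipation"
      by (rule continuous_on_subset[OF continuous_on_dissipation R(2)])
    show "lyap A ?q = 0" by (simp add: lyap_def)
    show "lyap A z > 0 \<and> dissipation z > 0" if "z \<in> cball ?q R" "z \<in> es_initial" "z \<noteq> ?q" for z
      using lyap_dissipation_pos[of z] that R(2) \<open>A > 0\<close> by blast
    show "lyap' A z (?fb z) \<le> - dissipation z" if "z \<in> cball ?q R" "z \<in> es_initial" for z
    proof -
      have z: "z \<in> \<Omega>" using that R(2) by blast
      \<comment> \<open>The centre has \<open>v = 0\<close>, so the radius bounds each coordinate of
        \<open>v\<close>, as \<open>lyap_decay\<close> demands.\<close>
      have "fst (snd z) $ i \<le> R" for i
      proof -
        have "fst (snd z) $ i = fst (snd (z - ?q)) $ i" by simp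
        also have "\<dots> \<le> norm (fst (snd (z - ?q)))" by (meson component_le_norm_cart abs_ge_self order_trans)
        also have "\<dots> \<le> norm (snd (z - ?q))" by (metis norm_fst_le prod.collapse)
        also have "\<dots> \<le> norm (z - ?q)" by (metis norm_snd_le prod.collapse)
        also have "\<dots> \<le> R" using that(1) by (metis dist_norm dist_commute mem_cball)
        finally show ?thesis .
      qed
      then show ?thesis
        using lyap_decay[OF z _ A] dither_averaged_field[of z g', OF z g'[OF z]] by simp
    qed
  qed
  show ?thesis unfolding field_eq by (rule practical_asymptotic_stability)
qed

end

theorem theorem3:
  fixes D :: "(real ^ 'n::finite) set" and xs :: "real ^ 'n" and J :: "real ^ 'n \<Rightarrow> real"
    and \<phi>1 \<phi>2 \<psi>11 \<psi>12 \<psi>21 \<psi>22 :: "real \<Rightarrow> real"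
    and \<epsilon> :: real and \<alpha> \<beta> \<gamma> :: "'n \<Rightarrow> real" and k l1 l2 :: "'n \<Rightarrow> nat"
  assumes "open D" and "connected D" and "xs \<in> D"
    and "C2_on D J"
    and "\<And>x. x \<in> D - {xs} \<Longrightarrow> J x > J xs"
    and "\<And>x. x \<in> D \<Longrightarrow> GDERIV J x :> 0 \<longleftrightarrow> x = xs"
    and "C2_on UNIV \<phi>1" and "C2_on UNIV \<phi>2"
    and "C2_on UNIV \<psi>11" and "C2_on UNIV \<psi>12" and "C2_on UNIV \<psi>21" and "C2_on UNIV \<psi>22"
    and "\<And>y. bracket \<phi>1 \<phi>2 y = - 1"
    and "\<And>y. \<psi>11 y * deriv \<psi>21 y + \<psi>12 y * deriv \<psi>22 y = 1"
    and "\<epsilon> > 0" and "\<And>i. \<alpha> i > 0" and "\<And>i. \<beta> i > 0" and "\<And>i. \<gamma> i > 0"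
    and "\<And>i. k i > 0" and "\<And>i. l1 i > 0" and "\<And>i. l2 i > 0"
    and "inj k" and "inj l1" and "inj l2"
    and "range k \<inter> range l1 = {}" and "range k \<inter> range l2 = {}" and "range l1 \<inter> range l2 = {}"
  shows "practically_uniformly_asymptotically_stable
           (es_field J \<phi>1 \<phi>2 \<psi>11 \<psi>12 \<psi>21 \<psi>22 \<epsilon> \<alpha> \<beta> \<gamma> k l1 l2)
           (es_domain D \<epsilon>) es_initial (xs, 0, 0)"
proof -
  obtain J' where J': "\<And>x. x \<in> D \<Longrightarrow> (J has_derivative blinfun_apply (J' x)) (at x)" "C1_on D J'"
    using C2_onE[OF assms(4)] by blast
  interpret es_system D xs J J' \<phi>1 \<phi>2 \<psi>11 \<psi>12 \<psi>21 \<psi>22 \<epsilon> \<alpha> \<beta> \<gamma> k l1 l2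
    by unfold_locales (fact assms J')+
  show ?thesis by (rule practical_stability)
qed

end
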